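(* There exists a thin sums matroid whose dual is not a thin sums matroid.
   Context: Matroids are allowed to have infinite ground sets. A matroid consists of a ground set $E$ and a set $\mathcal{I}$ of subsets of $E$ (the independent sets) satisfying: (I1) $\emptyset\in\mathcal{I}$; (I2) $\mathcal{I}$ is closed under taking subsets; (I3) whenever $I,I'\in\mathcal{I}$ with $I'$ maximal in $\mathcal{I}$ and $I$ not maximal, there is $x\in I'\setminus I$ with $I+x\in\mathcal{I}$; (IM) whenever $I\subseteq X\subseteq E$ and $I\in\mathcal{I}$, the set $\{I'\in\mathcal{I}\mid I\subseteq I'\subseteq X\}$ has a maximal element. Bases are the maximal independent sets. The dual $M^*$ of $M$ is the matroid on $E$ whose bases are the complements of the bases of $M$. Thin sums matroids: let $A$ be a set, $k$ a field, and $f=(f_e\mid e\in E)$ a family of functions from $A$ to $k$. A family $\lambda=(\lambda_e\mid e\in E)$ of elements of $k$ is a thin dependence of $f$ if for each $a\in A$ there are only finitely many $e\in E$ with $\lambda_e f_e(a)\neq 0$ and $\sum_{e\in E}\lambda_e f_e(a)=0$. A subset $I\subseteq E$ is thinly independent for $f$ if the only thin dependence of $f$ that is $0$ everywhere outside $I$ is the zero family. Let $M_f$ be the set of thinly independent sets for $f$. When $M_f$ is the set of independent sets of a matroid on $E$, this matroid is called the thin sums matroid of $f$. A matroid is a thin sums matroid (over $k$) if it is the thin sums matroid of some such family $f$ for some set $A$ (and the field $k$); it is a thin sums matroid if it is one over some field $k$. *)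

theory Defs
  imports "HOL-Algebra.Subrings" "HOL-Algebra.Weak_Morphisms"
begin

section \<open>Infinite matroids and duality\<close>

definition maximal_in :: "'e set set \<Rightarrow> 'e set \<Rightarrow> bool" where
  "maximal_in \<F> X \<longleftrightarrow> X \<in> \<F> \<and> (\<forall>Y\<in>\<F>. X \<subseteq> Y \<longrightarrow> Y = X)"

locale matroid =
  fixes E :: "'e set" and \<I> :: "'e set set"
  assumes indep_subset: "\<I> \<subseteq> Pow E"
    and I1: "{} \<in> \<I>"
    and I2: "\<lbrakk>I \<in> \<I>; J \<subseteq> I\<rbrakk> \<Longrightarrow> J \<in> \<I>"
    and I3: "\<lbrakk>I \<in> \<I>; maximal_in \<I> I'; \<not> maximal_in \<I> I\<rbrakk>
             \<Longrightarrow> \<exists>x\<in>I' - I. insert x I \<in> \<I>"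
    and IM: "\<lbrakk>I \<subseteq> X; X \<subseteq> E; I \<in> \<I>\<rbrakk>
             \<Longrightarrow> \<exists>J. maximal_in {I' \<in> \<I>. I \<subseteq> I' \<and> I' \<subseteq> X} J"

definition bases :: "'e set set \<Rightarrow> 'e set set" where
  "bases \<I> = {B. maximal_in \<I> B}"

text \<open>The independent sets of the dual, that is, the subsets of the complements of the bases;
  the lemmas \<open>matroid_dual\<close> and \<open>bases_dual\<close> below show that these form the matroid
  whose bases are the complements of the bases.\<close>

definition dual_indep :: "'e set \<Rightarrow> 'e set set \<Rightarrow> 'e set set" where
  "dual_indep E \<I> = {X. \<exists>B\<in>bases \<I>. X \<subseteq> E - B}"

context matroid
begin

lemma base_indep: "B \<in> bases \<I> \<Longrightarrow> B \<in> \<I>"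
  by (simp add: bases_def maximal_in_def)

lemma base_subset: "B \<in> bases \<I> \<Longrightarrow> B \<subseteq> E"
  using base_indep indep_subset by blast

lemma base_eq: "\<lbrakk>B \<in> bases \<I>; B \<subseteq> I; I \<in> \<I>\<rbrakk> \<Longrightarrow> I = B"
  by (auto simp: bases_def maximal_in_def)

lemma bases_nonempty: "\<exists>B. B \<in> bases \<I>"
proof -
  obtain J where "maximal_in {I' \<in> \<I>. {} \<subseteq> I' \<and> I' \<subseteq> E} J"
    using IM[of "{}" E] I1 by auto
  hence "maximal_in \<I> J"
    using indep_subset unfolding maximal_in_def by blast
  thus ?thesis by (auto simp: bases_def)
qed

lemma base_augment:
  assumes "I \<in> \<I>" "B \<in> bases \<I>" "I \<notin> bases \<I>"
  obtains x where "x \<in> B - I" "insert x I \<in> \<I>"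
  using I3[of I B] assms by (auto simp: bases_def)

lemma extend_in_spanning:
  assumes "I \<in> \<I>" "I \<subseteq> X" "X \<subseteq> E" "B \<in> bases \<I>" "B \<subseteq> X"
  obtains J where "J \<in> bases \<I>" "I \<subseteq> J" "J \<subseteq> X"
proof -
  obtain J where J: "maximal_in {I' \<in> \<I>. I \<subseteq> I' \<and> I' \<subseteq> X} J"
    using IM[OF assms(2,3,1)] by blast
  have J': "J \<in> \<I>" "I \<subseteq> J" "J \<subseteq> X" using J by (auto simp: maximal_in_def)
  have "J \<in> bases \<I>"
  proof (rule ccontr)
    assume "J \<notin> bases \<I>"
    then obtain x where x: "x \<in> B - J" "insert x J \<in> \<I>"
      using base_augment[OF J'(1) assms(4)] by blast
    hence "insert x J = J" using J J' assms(5) unfolding maximal_in_def by blast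
    thus False using x by blast
  qed
  thus ?thesis using that J' by blast
qed

lemma bases_dual: "bases (dual_indep E \<I>) = (\<lambda>B. E - B) ` bases \<I>"
proof (intro equalityI subsetI)
  fix X assume "X \<in> bases (dual_indep E \<I>)"
  hence X: "X \<in> dual_indep E \<I>" "\<And>Y. Y \<in> dual_indep E \<I> \<Longrightarrow> X \<subseteq> Y \<Longrightarrow> Y = X"
    by (auto simp: bases_def maximal_in_def)
  then obtain B where B: "B \<in> bases \<I>" "X \<subseteq> E - B" by (auto simp: dual_indep_def)
  have "E - B \<in> dual_indep E \<I>" using B by (auto simp: dual_indep_def)
  hence "X = E - B" using X(2)[of "E - B"] B(2) by simp
  thus "X \<in> (\<lambda>B. E - B) ` bases \<I>" using B by blast
next
  fix X assume "X \<in> (\<lambda>B. E - B) ` bases \<I>"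
  then obtain B where B: "B \<in> bases \<I>" "X = E - B" by blast
  have "Y = X" if Y: "Y \<in> dual_indep E \<I>" "X \<subseteq> Y" for Y
  proof -
    obtain B' where B': "B' \<in> bases \<I>" "Y \<subseteq> E - B'" using Y by (auto simp: dual_indep_def)
    have "B' \<subseteq> B" using B B' Y(2) base_subset by blast
    hence "B = B'" using base_eq[OF B'(1)] base_indep[OF B(1)] by blast
    thus ?thesis using B B' Y by blast
  qed
  moreover have "X \<in> dual_indep E \<I>" using B by (auto simp: dual_indep_def)
  ultimately show "X \<in> bases (dual_indep E \<I>)" by (auto simp: bases_def maximal_in_def)
qed

lemma matroid_dual: "matroid E (dual_indep E \<I>)"
proof
  show "dual_indep E \<I> \<subseteq> Pow E" by (auto simp: dual_indep_def)
  show "{} \<in> dual_indep E \<I>" using bases_nonempty by (auto simp: dual_indep_def)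
  show "J \<in> dual_indep E \<I>" if "I \<in> dual_indep E \<I>" "J \<subseteq> I" for I J
    using that by (auto simp: dual_indep_def)
next
  fix I I' assume I: "I \<in> dual_indep E \<I>" and "maximal_in (dual_indep E \<I>) I'"
    and nmax: "\<not> maximal_in (dual_indep E \<I>) I"
  then obtain B' where B': "B' \<in> bases \<I>" "I' = E - B'"
    using bases_dual by (auto simp: bases_def)
  obtain B where B: "B \<in> bases \<I>" "I \<subseteq> E - B" using I by (auto simp: dual_indep_def)
  have "E - B \<in> bases (dual_indep E \<I>)" using bases_dual B by blast
  hence "I \<noteq> E - B" using nmax by (auto simp: bases_def)
  then obtain y where y: "y \<in> E - B" "y \<notin> I" using B by blast
  show "\<exists>x\<in>I' - I. insert x I \<in> dual_indep E \<I>"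
  proof (cases "\<exists>x. x \<in> I' - I \<and> x \<notin> B")
    case True
    then obtain x where x: "x \<in> I' - I" "x \<notin> B" by blast
    have "insert x I \<subseteq> E - B" using x B B' by blast
    thus ?thesis using x B(1) unfolding dual_indep_def by blast
  next
    case False
    have "y \<in> B'" using False y B' by blast
    have "B' - I \<in> \<I>" using I2[OF base_indep[OF B'(1)]] by blast
    moreover have "B' - I \<subseteq> E - I" using base_subset[OF B'(1)] by blast
    moreover have "B \<subseteq> E - I" using B base_subset by blast
    ultimately obtain Z where Z: "Z \<in> bases \<I>" "B' - I \<subseteq> Z" "Z \<subseteq> E - I"
      using extend_in_spanning[of "B' - I" "E - I" B] B(1) by blast
    have "y \<in> Z" using \<open>y \<in> B'\<close> y Z by blast
    hence "\<not> B \<subseteq> Z" using base_eq[OF B(1) _ base_indep[OF Z(1)]] y by blast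
    then obtain x where x: "x \<in> B" "x \<notin> Z" by blast
    have "x \<notin> I" using x B by blast
    hence "x \<in> I' - I" using x Z B' base_subset[OF B(1)] by blast
    moreover have "insert x I \<subseteq> E - Z" using x Z B base_subset[OF B(1)] by blast
    ultimately show ?thesis using Z(1) unfolding dual_indep_def by blast
  qed
next
  fix I X assume IX: "I \<subseteq> X" "X \<subseteq> E" "I \<in> dual_indep E \<I>"
  then obtain B where B: "B \<in> bases \<I>" "I \<subseteq> E - B" by (auto simp: dual_indep_def)
  obtain J where J: "maximal_in {I' \<in> \<I>. {} \<subseteq> I' \<and> I' \<subseteq> E - X} J"
    using IM[of "{}" "E - X"] I1 by auto
  have J': "J \<in> \<I>" "J \<subseteq> E - X" using J by (auto simp: maximal_in_def)
  obtain B' where B': "B' \<in> bases \<I>" "J \<subseteq> B'" "B' \<subseteq> E - I"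
    using extend_in_spanning[of J "E - I" B] J' IX B base_subset[OF B(1)] by blast
  have "maximal_in {Y \<in> dual_indep E \<I>. I \<subseteq> Y \<and> Y \<subseteq> X} (X - B')"
    unfolding maximal_in_def
  proof (intro conjI ballI impI)
    show "X - B' \<in> {Y \<in> dual_indep E \<I>. I \<subseteq> Y \<and> Y \<subseteq> X}"
      using B' IX by (auto simp: dual_indep_def)
  next
    fix Y assume "Y \<in> {Y \<in> dual_indep E \<I>. I \<subseteq> Y \<and> Y \<subseteq> X}" and XY: "X - B' \<subseteq> Y"
    then obtain B2 where Y: "Y \<subseteq> X" and B2: "B2 \<in> bases \<I>" "Y \<subseteq> E - B2"
      by (auto simp: dual_indep_def)
    show "Y = X - B'"
    proof (rule ccontr)
      assume "Y \<noteq> X - B'"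
      then obtain z where z: "z \<in> Y" "z \<in> B'" using XY Y by blast
      have zB2: "z \<notin> B2" using z B2 by blast
      have ind: "B' - {z} \<in> \<I>" using I2[OF base_indep[OF B'(1)]] by blast
      have "B' - {z} \<notin> bases \<I>" using base_eq[of "B' - {z}" B'] base_indep[OF B'(1)] z by blast
      then obtain x where x: "x \<in> B2 - (B' - {z})" "insert x (B' - {z}) \<in> \<I>"
        using base_augment[OF ind B2(1)] by blast
      have xB': "x \<notin> B'" using x zB2 by blast
      have "x \<notin> X" using x xB' XY B2 by blast
      have "insert x J \<subseteq> insert x (B' - {z})" using B' J' z Y by blast
      hence "insert x J \<in> \<I>" using I2[OF x(2)] by blast
      moreover have "insert x J \<subseteq> E - X" using J' x \<open>x \<notin> X\<close> base_subset[OF B2(1)] by blast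
      ultimately have "insert x J = J" using J unfolding maximal_in_def by blast
      thus False using xB' B' by blast
    qed
  qed
  thus "\<exists>J. maximal_in {Y \<in> dual_indep E \<I>. I \<subseteq> Y \<and> Y \<subseteq> X} J" by (rule exI)
qed

end

section \<open>Thin sums matroids\<close>

text \<open>The sum over \<open>E\<close> is taken over the finite set of indices with nonzero summand.
  The values of \<open>l\<close> and \<open>f\<close> at indices outside \<open>E\<close> are irrelevant.\<close>

definition thin_dependence ::
  "('k, 'm) ring_scheme \<Rightarrow> 'a set \<Rightarrow> 'e set \<Rightarrow> ('e \<Rightarrow> 'a \<Rightarrow> 'k) \<Rightarrow> ('e \<Rightarrow> 'k) \<Rightarrow> bool" where
  "thin_dependence K A E f l \<longleftrightarrow>
     l \<in> E \<rightarrow> carrier K \<and>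
     (\<forall>a\<in>A. finite {e \<in> E. l e \<otimes>\<^bsub>K\<^esub> f e a \<noteq> \<zero>\<^bsub>K\<^esub>} \<and>
            (\<Oplus>\<^bsub>K\<^esub>e\<in>{e \<in> E. l e \<otimes>\<^bsub>K\<^esub> f e a \<noteq> \<zero>\<^bsub>K\<^esub>}. l e \<otimes>\<^bsub>K\<^esub> f e a) = \<zero>\<^bsub>K\<^esub>)"

definition thinly_indep ::
  "('k, 'm) ring_scheme \<Rightarrow> 'a set \<Rightarrow> 'e set \<Rightarrow> ('e \<Rightarrow> 'a \<Rightarrow> 'k) \<Rightarrow> 'e set set" where
  "thinly_indep K A E f =
     {I. I \<subseteq> E \<and> (\<forall>l. thin_dependence K A E f l \<and> (\<forall>e\<in>E - I. l e = \<zero>\<^bsub>K\<^esub>)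
                       \<longrightarrow> (\<forall>e\<in>E. l e = \<zero>\<^bsub>K\<^esub>))}"

definition is_thin_sums_matroid_of ::
  "('k, 'm) ring_scheme \<Rightarrow> 'a set \<Rightarrow> 'e set \<Rightarrow> ('e \<Rightarrow> 'a \<Rightarrow> 'k) \<Rightarrow> 'e set set \<Rightarrow> bool" where
  "is_thin_sums_matroid_of K A E f \<I> \<longleftrightarrow>
     field K \<and> f \<in> E \<rightarrow> A \<rightarrow> carrier K \<and> matroid E \<I> \<and> \<I> = thinly_indep K A E f"

text \<open>A formula cannot quantify over all types, so the field and the set \<open>A\<close> are taken from
  one fixed type, which has at least \<open>2\<^sup>\<kappa>\<close> elements for \<open>\<kappa> = max \<bar>E\<bar> \<aleph>\<^sub>0\<close>. This loses nothing:
  the theorem \<open>thin_sums_matroidI\<close> below shows that a matroid that is the thin sums matroid of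
  a family over a field of any type, with a set \<open>A\<close> of any type, satisfies this definition.\<close>

type_synonym 'e universe = "('e + nat) list set"

definition thin_sums_matroid_over :: "'e universe ring \<Rightarrow> 'e set \<Rightarrow> 'e set set \<Rightarrow> bool" where
  "thin_sums_matroid_over K E \<I> \<longleftrightarrow>
     (\<exists>(A :: 'e universe set) f. is_thin_sums_matroid_of K A E f \<I>)"

definition thin_sums_matroid :: "'e set \<Rightarrow> 'e set set \<Rightarrow> bool" where
  "thin_sums_matroid E \<I> \<longleftrightarrow> (\<exists>K. thin_sums_matroid_over K E \<I>)"

section \<open>Independence of the choice of types\<close>

text \<open>Given a family over a field of arbitrary type, pick a nonzero thin dependence for every
  dependent set, and for every vector that is not a thin dependence a row \<open>a\<close> witnessing this.
  The closure of the chosen coefficients under the field operations and under adding the entries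
  of the witnessing rows is a subfield; its elements are named by the following terms.\<close>

datatype 'e trm =
    Con bool
  | Dep "'e set" 'e
  | Bin bool "'e trm" "'e trm"
  | Row "'e \<Rightarrow> 'e trm" 'e

primrec enc :: "'e trm \<Rightarrow> 'e universe" where
  "enc (Con b) = {[Inr (if b then 0 else 1)]}"
| "enc (Dep D e) = insert [Inr 2, Inl e] ((\<lambda>x. [Inr 3, Inl x]) ` D)"
| "enc (Bin b s t) = insert [Inr (if b then 4 else 5)]
     ((\<lambda>p. Inr 6 # p) ` enc s \<union> (\<lambda>p. Inr 7 # p) ` enc t)"
| "enc (Row g e) = insert [Inr 8, Inl e] (\<Union>x. (\<lambda>p. Inr 9 # Inl x # p) ` enc (g x))"

lemma enc_eqD: "enc s = enc t \<Longrightarrow> s = t"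
proof (induction s arbitrary: t)
  case (Con b)
  then show ?case
    using eqset_imp_iff[OF Con.prems, of "[Inr (if b then 0 else 1)]"]
    by (cases t) (auto split: if_splits)
next
  case (Dep D e)
  show ?case
  proof (cases t)
    case (Dep D' e')
    note eq = Dep.prems[unfolded Dep]
    have "e = e'" using eqset_imp_iff[OF eq, of "[Inr 2, Inl e]"] by auto
    moreover have "x \<in> D \<longleftrightarrow> x \<in> D'" for x
      using eqset_imp_iff[OF eq, of "[Inr 3, Inl x]"] by auto
    ultimately show ?thesis using Dep by auto
  next
    case (Con b)
    then show ?thesis using eqset_imp_iff[OF Dep.prems, of "[Inr 2, Inl e]"] by auto
  next
    case (Bin b u v)
    then show ?thesis using eqset_imp_iff[OF Dep.prems, of "[Inr 2, Inl e]"] by auto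
  next
    case (Row g d)
    then show ?thesis using eqset_imp_iff[OF Dep.prems, of "[Inr 2, Inl e]"] by auto
  qed
next
  case (Bin b u v)
  let ?w = "[Inr (if b then 4 else 5)]"
  show ?case
  proof (cases t)
    case (Bin b' u' v')
    note eq = Bin.prems[unfolded Bin]
    have "b = b'" using eqset_imp_iff[OF eq, of ?w] by (auto split: if_splits)
    moreover have "p \<in> enc u \<longleftrightarrow> p \<in> enc u'" for p
      using eqset_imp_iff[OF eq, of "Inr 6 # p"] by (auto split: if_splits)
    moreover have "p \<in> enc v \<longleftrightarrow> p \<in> enc v'" for p
      using eqset_imp_iff[OF eq, of "Inr 7 # p"] by (auto split: if_splits)
    ultimately show ?thesis using Bin Bin.IH by blast
  next
    case (Con b)
    then show ?thesis using eqset_imp_iff[OF Bin.prems, of ?w] by (auto split: if_splits)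
  next
    case (Dep b u)
    then show ?thesis using eqset_imp_iff[OF Bin.prems, of ?w] by (auto split: if_splits)
  next
    case (Row g d)
    then show ?thesis using eqset_imp_iff[OF Bin.prems, of ?w] by (auto split: if_splits)
  qed
next
  case (Row g e)
  show ?case
  proof (cases t)
    case (Row g' e')
    note eq = Row.prems[unfolded Row]
    have "e = e'" using eqset_imp_iff[OF eq, of "[Inr 8, Inl e]"] by auto
    moreover have "p \<in> enc (g x) \<longleftrightarrow> p \<in> enc (g' x)" for p x
      using eqset_imp_iff[OF eq, of "Inr 9 # Inl x # p"] by auto
    hence "g x = g' x" for x by (intro Row.IH) auto
    hence "g = g'" by blast
    ultimately show ?thesis using Row by simp
  next
    case (Con b)
    then show ?thesis using eqset_imp_iff[OF Row.prems, of "[Inr 8, Inl e]"] by auto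
  next
    case (Bin b u v)
    then show ?thesis using eqset_imp_iff[OF Row.prems, of "[Inr 8, Inl e]"] by auto
  next
    case (Dep g d)
    then show ?thesis using eqset_imp_iff[OF Row.prems, of "[Inr 8, Inl e]"] by auto
  qed
qed

lemma inj_enc: "inj enc"
  using enc_eqD by (rule injI)


primrec val ::
  "('k, 'm) ring_scheme \<Rightarrow> ('e set \<Rightarrow> 'e \<Rightarrow> 'k) \<Rightarrow> (('e \<Rightarrow> 'k) \<Rightarrow> 'e \<Rightarrow> 'k) \<Rightarrow> 'e trm \<Rightarrow> 'k" where
  "val K \<delta> \<rho> (Con b) = (if b then \<one>\<^bsub>K\<^esub> else \<zero>\<^bsub>K\<^esub>)"
| "val K \<delta> \<rho> (Dep D e) = \<delta> D e"
| "val K \<delta> \<rho> (Bin b s t) =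
     (if b then val K \<delta> \<rho> s \<ominus>\<^bsub>K\<^esub> val K \<delta> \<rho> t
      else if val K \<delta> \<rho> t = \<zero>\<^bsub>K\<^esub> then \<zero>\<^bsub>K\<^esub>
      else val K \<delta> \<rho> s \<otimes>\<^bsub>K\<^esub> inv\<^bsub>K\<^esub> val K \<delta> \<rho> t)"
| "val K \<delta> \<rho> (Row g e) = \<rho> (\<lambda>x. val K \<delta> \<rho> (g x)) e"

lemma subfield_range_val:
  assumes "field K" and \<delta>: "\<And>D e. \<delta> D e \<in> carrier K" and \<rho>: "\<And>l e. \<rho> l e \<in> carrier K"
  shows "subfield (range (val K \<delta> \<rho>)) K"
proof -
  interpret field K by fact
  let ?v = "val K \<delta> \<rho>"
  let ?S = "range ?v"
  have sub: "?v t \<in> carrier K" for t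
  proof (induction t)
    case (Bin b s t)
    then show ?case using field_Units by auto
  qed (auto simp: \<delta> \<rho>)
  have z: "\<zero>\<^bsub>K\<^esub> \<in> ?S" by (rule range_eqI[of _ _ "Con False"]) simp
  have o: "\<one>\<^bsub>K\<^esub> \<in> ?S" by (rule range_eqI[of _ _ "Con True"]) simp
  have car: "x \<in> carrier K" if "x \<in> ?S" for x using that sub by blast
  have diff: "x \<ominus>\<^bsub>K\<^esub> y \<in> ?S" if xy: "x \<in> ?S" "y \<in> ?S" for x y
  proof -
    obtain s t where "x = ?v s" "y = ?v t" using xy by blast
    thus ?thesis by (intro range_eqI[of _ _ "Bin True s t"]) simp
  qed
  have quot: "x \<otimes>\<^bsub>K\<^esub> inv\<^bsub>K\<^esub> y \<in> ?S" if xy: "x \<in> ?S" "y \<in> ?S" "y \<noteq> \<zero>\<^bsub>K\<^esub>" for x y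
  proof -
    obtain s t where "x = ?v s" "y = ?v t" using xy by blast
    thus ?thesis using xy(3) by (intro range_eqI[of _ _ "Bin False s t"]) simp
  qed
  have neg: "\<ominus>\<^bsub>K\<^esub> x \<in> ?S" if "x \<in> ?S" for x
    using diff[OF z that] car[OF that] by (simp add: minus_eq)
  have inverse: "inv\<^bsub>K\<^esub> x \<in> ?S" if "x \<in> ?S" "x \<noteq> \<zero>\<^bsub>K\<^esub>" for x
    using quot[OF o that] car[OF that(1)] that(2) field_Units by simp
  show ?thesis
  proof (rule subfieldI')
    show "subring ?S K"
    proof (rule subringI)
      show "?S \<subseteq> carrier K" using car by blast
      show "x \<oplus>\<^bsub>K\<^esub> y \<in> ?S" if "x \<in> ?S" "y \<in> ?S" for x y
        using diff[OF that(1) neg[OF that(2)]] car that by (simp add: minus_eq)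
      show "x \<otimes>\<^bsub>K\<^esub> y \<in> ?S" if xy: "x \<in> ?S" "y \<in> ?S" for x y
      proof (cases "y = \<zero>\<^bsub>K\<^esub>")
        case True
        then show ?thesis using z car[OF xy(1)] by simp
      next
        case False
        hence u: "y \<in> Units K" using car[OF xy(2)] field_Units by simp
        hence "inv\<^bsub>K\<^esub> y \<noteq> \<zero>\<^bsub>K\<^esub>" using Units_inv_Units field_Units by blast
        thus ?thesis using quot[OF xy(1) inverse[OF xy(2) False]] u by simp
      qed
    qed (use o neg in auto)
    show "inv\<^bsub>K\<^esub> x \<in> ?S" if "x \<in> ?S - {\<zero>\<^bsub>K\<^esub>}" for x
      using inverse that by blast
  qed
qed

lemma thin_dependence_cong:
  assumes "field K" and f: "f \<in> E \<rightarrow> A \<rightarrow> carrier K" and l': "l' \<in> E \<rightarrow> carrier K"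
    and eq: "\<And>e. e \<in> E \<Longrightarrow> l e = l' e"
  shows "thin_dependence K A E f l \<longleftrightarrow> thin_dependence K A E f l'"
proof -
  interpret field K by fact
  have supp: "{e \<in> E. l e \<otimes>\<^bsub>K\<^esub> f e a \<noteq> \<zero>\<^bsub>K\<^esub>} = {e \<in> E. l' e \<otimes>\<^bsub>K\<^esub> f e a \<noteq> \<zero>\<^bsub>K\<^esub>}" for a
    using eq by auto
  have fs: "(\<Oplus>\<^bsub>K\<^esub>e\<in>{e \<in> E. l' e \<otimes>\<^bsub>K\<^esub> f e a \<noteq> \<zero>\<^bsub>K\<^esub>}. l e \<otimes>\<^bsub>K\<^esub> f e a) =
      (\<Oplus>\<^bsub>K\<^esub>e\<in>{e \<in> E. l' e \<otimes>\<^bsub>K\<^esub> f e a \<noteq> \<zero>\<^bsub>K\<^esub>}. l' e \<otimes>\<^bsub>K\<^esub> f e a)" if "a \<in> A" for a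
  proof (rule finsum_cong')
    show "(\<lambda>e. l' e \<otimes>\<^bsub>K\<^esub> f e a) \<in> {e \<in> E. l' e \<otimes>\<^bsub>K\<^esub> f e a \<noteq> \<zero>\<^bsub>K\<^esub>} \<rightarrow> carrier K"
    proof
      fix e assume "e \<in> {e \<in> E. l' e \<otimes>\<^bsub>K\<^esub> f e a \<noteq> \<zero>\<^bsub>K\<^esub>}"
      hence "l' e \<in> carrier K" "f e a \<in> carrier K" using f l' that by blast+
      thus "l' e \<otimes>\<^bsub>K\<^esub> f e a \<in> carrier K" by simp
    qed
  qed (simp_all add: eq)
  have "l \<in> E \<rightarrow> carrier K" using l' eq by (auto simp: Pi_iff)
  thus ?thesis unfolding thin_dependence_def supp using l' fs by simp
qed

lemma thin_dependence_hom:
  assumes "ring_hom_cring K' K \<phi>" and inj: "inj_on \<phi> (carrier K')"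
    and l: "l \<in> E \<rightarrow> carrier K'" and f': "f' \<in> E \<rightarrow> A' \<rightarrow> carrier K'"
    and f: "\<And>e a. e \<in> E \<Longrightarrow> a \<in> A' \<Longrightarrow> \<phi> (f' e a) = f e (p a)"
  shows "thin_dependence K' A' E f' l \<longleftrightarrow> thin_dependence K (p ` A') E f (\<lambda>e. \<phi> (l e))"
proof -
  interpret ring_hom_cring K' K \<phi> by fact
  have zero_iff: "\<phi> x = \<zero>\<^bsub>K\<^esub> \<longleftrightarrow> x = \<zero>\<^bsub>K'\<^esub>" if "x \<in> carrier K'" for x
    using inj_onD[OF inj, of x "\<zero>\<^bsub>K'\<^esub>"] that by auto
  have lc: "l e \<in> carrier K'" if "e \<in> E" for e using l that by blast
  have fc: "f' e a \<in> carrier K'" if "e \<in> E" "a \<in> A'" for e a using f' that by blast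
  have hom_prod: "\<phi> (l e) \<otimes>\<^bsub>K\<^esub> f e (p a) = \<phi> (l e \<otimes>\<^bsub>K'\<^esub> f' e a)" if "e \<in> E" "a \<in> A'" for e a
    using lc fc f that by simp
  have supp: "{e \<in> E. \<phi> (l e) \<otimes>\<^bsub>K\<^esub> f e (p a) \<noteq> \<zero>\<^bsub>K\<^esub>} = {e \<in> E. l e \<otimes>\<^bsub>K'\<^esub> f' e a \<noteq> \<zero>\<^bsub>K'\<^esub>}"
    if "a \<in> A'" for a
  proof -
    have "\<phi> (l e) \<otimes>\<^bsub>K\<^esub> f e (p a) = \<zero>\<^bsub>K\<^esub> \<longleftrightarrow> l e \<otimes>\<^bsub>K'\<^esub> f' e a = \<zero>\<^bsub>K'\<^esub>" if "e \<in> E" for e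
      unfolding hom_prod[OF that \<open>a \<in> A'\<close>] by (rule zero_iff) (use lc fc that \<open>a \<in> A'\<close> in simp)
    thus ?thesis by blast
  qed
  have sum: "(\<Oplus>\<^bsub>K\<^esub>e\<in>S. \<phi> (l e) \<otimes>\<^bsub>K\<^esub> f e (p a)) = \<phi> (\<Oplus>\<^bsub>K'\<^esub>e\<in>S. l e \<otimes>\<^bsub>K'\<^esub> f' e a)"
    if "a \<in> A'" "S \<subseteq> E" for a S
  proof -
    have "(\<lambda>e. l e \<otimes>\<^bsub>K'\<^esub> f' e a) \<in> S \<rightarrow> carrier K'" using lc fc that by blast
    hence "\<phi> (\<Oplus>\<^bsub>K'\<^esub>e\<in>S. l e \<otimes>\<^bsub>K'\<^esub> f' e a) = (\<Oplus>\<^bsub>K\<^esub>e\<in>S. \<phi> (l e \<otimes>\<^bsub>K'\<^esub> f' e a))"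
      by (simp add: o_def)
    also have "\<dots> = (\<Oplus>\<^bsub>K\<^esub>e\<in>S. \<phi> (l e) \<otimes>\<^bsub>K\<^esub> f e (p a))"
      by (rule S.finsum_cong') (use lc fc hom_prod that in \<open>auto simp del: hom_mult\<close>)
    finally show ?thesis by simp
  qed
  have closed: "(\<Oplus>\<^bsub>K'\<^esub>e\<in>S. l e \<otimes>\<^bsub>K'\<^esub> f' e a) \<in> carrier K'" if "a \<in> A'" "S \<subseteq> E" for a S
    by (rule R.finsum_closed) (use lc fc that in blast)
  have "(\<lambda>e. \<phi> (l e)) \<in> E \<rightarrow> carrier K" using lc by simp
  thus ?thesis
    using l supp sum zero_iff closed by (simp add: thin_dependence_def)
qed

theorem thin_sums_matroidI:
  fixes E :: "'e set"
  assumes "is_thin_sums_matroid_of K A E f \<I>"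
  shows "thin_sums_matroid E \<I>"
proof -
  have K: "field K" and f: "f \<in> E \<rightarrow> A \<rightarrow> carrier K" and M: "matroid E \<I>"
    and \<I>: "\<I> = thinly_indep K A E f"
    using assms by (auto simp: is_thin_sums_matroid_of_def)
  interpret K: field K by fact
  let ?td = "\<lambda>A. thin_dependence K A E f"
  let ?dep = "\<lambda>D l. ?td A l \<and> (\<forall>e\<in>E - D. l e = \<zero>\<^bsub>K\<^esub>) \<and> (\<exists>e\<in>E. l e \<noteq> \<zero>\<^bsub>K\<^esub>)"
  let ?bad = "\<lambda>l a. a \<in> A \<and> \<not> ?td {a} l"
  define w where "w l = (SOME a. ?bad l a)" for l
  define \<delta> where "\<delta> D e = (if e \<in> E \<and> (\<exists>l. ?dep D l) then (SOME l. ?dep D l) e else \<zero>\<^bsub>K\<^esub>)" for D e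
  define \<rho> where "\<rho> l e = (if e \<in> E \<and> (\<exists>a. ?bad l a) then f e (w l) else \<zero>\<^bsub>K\<^esub>)" for l e
  have w: "?bad l (w l)" if "\<exists>a. ?bad l a" for l
    unfolding w_def using that by (rule someI_ex)
  have \<delta>: "?dep D (\<delta> D)" if ex: "\<exists>l. ?dep D l" for D
  proof -
    define m where "m = (SOME l. ?dep D l)"
    have m: "?dep D m" unfolding m_def using ex by (rule someI_ex)
    have "\<delta> D e = m e" if "e \<in> E" for e using that ex by (simp add: \<delta>_def m_def)
    moreover have "m \<in> E \<rightarrow> carrier K" using m by (simp add: thin_dependence_def)
    ultimately have "?td A (\<delta> D) \<longleftrightarrow> ?td A m" by (intro thin_dependence_cong K f)
    thus ?thesis using m \<open>\<And>e. e \<in> E \<Longrightarrow> \<delta> D e = m e\<close> by auto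
  qed
  have \<delta>c: "\<delta> D e \<in> carrier K" for D e
  proof (cases "e \<in> E \<and> (\<exists>l. ?dep D l)")
    case True
    hence "?td A (\<delta> D)" using \<delta>[of D] by blast
    thus ?thesis using True unfolding thin_dependence_def by blast
  next
    case False
    hence "\<delta> D e = \<zero>\<^bsub>K\<^esub>" unfolding \<delta>_def by (rule if_not_P)
    thus ?thesis by simp
  qed
  have \<rho>c: "\<rho> l e \<in> carrier K" for l e
    using w[of l] f by (auto simp: \<rho>_def)
  let ?v = "val K \<delta> \<rho>"
  define S where "S = range ?v"
  have "subfield S K" unfolding S_def by (intro subfield_range_val K \<delta>c \<rho>c)
  hence K0: "field (K\<lparr>carrier := S\<rparr>)" and SK: "S \<subseteq> carrier K" and zS: "\<zero>\<^bsub>K\<^esub> \<in> S"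
    and oS: "\<one>\<^bsub>K\<^esub> \<in> S"
    and addS: "\<And>x y. x \<in> S \<Longrightarrow> y \<in> S \<Longrightarrow> x \<oplus>\<^bsub>K\<^esub> y \<in> S"
    and multS: "\<And>x y. x \<in> S \<Longrightarrow> y \<in> S \<Longrightarrow> x \<otimes>\<^bsub>K\<^esub> y \<in> S"
    using K.subfield_iff(2) subringE[OF subfieldE(1)[of S K]] by auto
  define h where "h x = enc (SOME t. ?v t = x)" for x
  have inj_h: "inj_on h S"
  proof (rule inj_onI)
    fix x y assume "x \<in> S" "y \<in> S" and "h x = h y"
    hence "?v (SOME t. ?v t = x) = x" "?v (SOME t. ?v t = y) = y"
      by (auto simp: S_def intro: someI)
    thus "x = y" using \<open>h x = h y\<close> enc_eqD unfolding h_def by metis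
  qed
  define K' where "K' = image_ring h (K\<lparr>carrier := S\<rparr>)"
  define \<phi> where "\<phi> = inv_into S h"
  have \<phi>h: "\<phi> (h x) = x" if "x \<in> S" for x using that inj_h by (simp add: \<phi>_def)
  have K': "field K'" unfolding K'_def
    by (rule field.inj_imp_image_ring_is_field[OF K0]) (simp add: inj_h)
  have carK': "carrier K' = h ` S" by (simp add: K'_def image_ring_carrier)
  have zK': "\<zero>\<^bsub>K'\<^esub> = h \<zero>\<^bsub>K\<^esub>" by (simp add: K'_def image_ring_zero)
  have hom: "\<phi> \<in> ring_hom K' K"
  proof (rule ring_hom_memI)
    show "\<phi> x \<in> carrier K" if "x \<in> carrier K'" for x using that carK' \<phi>h SK by auto
    show "\<phi> \<one>\<^bsub>K'\<^esub> = \<one>\<^bsub>K\<^esub>" by (simp add: K'_def image_ring_one \<phi>h oS)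
    show "\<phi> (x \<otimes>\<^bsub>K'\<^esub> y) = \<phi> x \<otimes>\<^bsub>K\<^esub> \<phi> y" if "x \<in> carrier K'" "y \<in> carrier K'" for x y
      using that \<phi>h multS
      by (auto simp: K'_def image_ring_carrier image_ring_def image_group_def monoid.defs
          simp flip: \<phi>_def)
    show "\<phi> (x \<oplus>\<^bsub>K'\<^esub> y) = \<phi> x \<oplus>\<^bsub>K\<^esub> \<phi> y" if "x \<in> carrier K'" "y \<in> carrier K'" for x y
      using that \<phi>h addS
      by (auto simp: K'_def image_ring_carrier image_ring_def image_group_def monoid.defs
          simp flip: \<phi>_def)
  qed
  interpret K': field K' by fact
  have rh: "ring_hom_cring K' K \<phi>"
    by (intro ring_hom_cring.intro ring_hom_cring_axioms.intro K'.is_cring K.is_cring hom)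
  have inj_\<phi>: "inj_on \<phi> (carrier K')" using \<phi>h by (auto simp: carK' inj_on_def)
  define row where "row g = enc (Row g undefined)" for g :: "'e \<Rightarrow> 'e trm"
  define G where "G = {g. \<exists>a. ?bad (\<lambda>x. ?v (g x)) a}"
  define A' where "A' = row ` G"
  define p where "p u = w (\<lambda>x. ?v (inv_into UNIV row u x))" for u
  have "inj row" by (auto simp: row_def inj_def dest!: enc_eqD simp del: enc.simps)
  hence p_row: "p (row g) = w (\<lambda>x. ?v (g x))" for g by (simp add: p_def)
  have pA: "p ` A' \<subseteq> A"
  proof
    fix a assume "a \<in> p ` A'"
    then obtain g where g: "g \<in> G" "a = w (\<lambda>x. ?v (g x))" using p_row by (auto simp: A'_def)
    have "\<exists>a. ?bad (\<lambda>x. ?v (g x)) a" using g(1) unfolding G_def by (rule CollectD)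
    thus "a \<in> A" using w g(2) by blast
  qed
  have fS: "f e (p u) \<in> S" if eu: "e \<in> E" "u \<in> A'" for e u
  proof -
    obtain g where g: "g \<in> G" "u = row g" using eu by (auto simp: A'_def)
    have "?v (Row g e) = f e (p u)" using g eu by (simp add: \<rho>_def G_def p_row)
    thus ?thesis unfolding S_def by (metis rangeI)
  qed
  define f' where "f' e u = h (f e (p u))" for e u
  have f': "f' \<in> E \<rightarrow> A' \<rightarrow> carrier K'" using fS by (auto simp: f'_def carK')
  have ff: "\<phi> (f' e a) = f e (p a)" if "e \<in> E" "a \<in> A'" for e a
    using fS that by (simp add: f'_def \<phi>h)
  have td_iff: "thin_dependence K' A' E f' l \<longleftrightarrow> ?td (p ` A') (\<lambda>e. \<phi> (l e))"
    if "l \<in> E \<rightarrow> carrier K'" for l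
    using thin_dependence_hom[of K' K \<phi> l E f' A' f p] rh inj_\<phi> that f' ff by blast
  have td_rows: "?td B l \<longleftrightarrow> l \<in> E \<rightarrow> carrier K \<and> (\<forall>a\<in>B. ?td {a} l)" for B l
    by (auto simp: thin_dependence_def)
  have "I \<in> thinly_indep K' A' E f' \<longleftrightarrow> I \<in> thinly_indep K A E f" if IE: "I \<subseteq> E" for I
  proof
    assume ind: "I \<in> thinly_indep K' A' E f'"
    show "I \<in> thinly_indep K A E f"
    proof (rule ccontr)
      assume "I \<notin> thinly_indep K A E f"
      hence "\<exists>l. ?dep I l" using IE by (auto simp: thinly_indep_def)
      note d = \<delta>[OF this]
      define l where "l e = h (\<delta> I e)" for e
      have dS: "\<delta> I e \<in> S" for e unfolding S_def by (rule range_eqI[of _ _ "Dep I e"]) simp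
      have \<phi>l: "\<phi> (l e) = \<delta> I e" for e using dS \<phi>h by (simp add: l_def)
      have "?td A (\<delta> I)" using d by (rule conjunct1)
      hence "?td (p ` A') (\<delta> I)"
        using pA td_rows[of A "\<delta> I"] td_rows[of "p ` A'" "\<delta> I"] by auto
      moreover have "l \<in> E \<rightarrow> carrier K'" using dS by (auto simp: l_def carK')
      ultimately have "thin_dependence K' A' E f' l" using td_iff \<phi>l by simp
      moreover have "\<forall>e\<in>E - I. l e = \<zero>\<^bsub>K'\<^esub>" using d by (simp add: l_def zK')
      ultimately have "\<forall>e\<in>E. l e = \<zero>\<^bsub>K'\<^esub>" using ind unfolding thinly_indep_def by blast
      hence "\<forall>e\<in>E. \<delta> I e = \<zero>\<^bsub>K\<^esub>" using \<phi>l zK' \<phi>h[OF zS] by metis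
      thus False using d by blast
    qed
  next
    assume ind: "I \<in> thinly_indep K A E f"
    have "\<forall>e\<in>E. l e = \<zero>\<^bsub>K'\<^esub>"
      if l: "thin_dependence K' A' E f' l" "\<forall>e\<in>E - I. l e = \<zero>\<^bsub>K'\<^esub>" for l
    proof -
      have lc: "l \<in> E \<rightarrow> carrier K'" using l by (simp add: thin_dependence_def)
      define m where "m e = (if e \<in> E then \<phi> (l e) else \<zero>\<^bsub>K\<^esub>)" for e
      have mS: "m e \<in> S" for e
      proof (cases "e \<in> E")
        case True
        then obtain x where "x \<in> S" "l e = h x" using lc carK' by blast
        thus ?thesis using True \<phi>h by (simp add: m_def)
      qed (simp add: m_def zS)
      have "?td (p ` A') (\<lambda>e. \<phi> (l e))" using td_iff[OF lc] l by blast
      moreover have "?td (p ` A') m \<longleftrightarrow> ?td (p ` A') (\<lambda>e. \<phi> (l e))"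
      proof (rule thin_dependence_cong[OF K])
        show "f \<in> E \<rightarrow> p ` A' \<rightarrow> carrier K" using f pA by blast
        show "(\<lambda>e. \<phi> (l e)) \<in> E \<rightarrow> carrier K" using calculation by (simp add: thin_dependence_def)
      qed (simp add: m_def)
      ultimately have m: "?td (p ` A') m" by blast
      have "?td A m"
      proof (rule ccontr)
        assume nd: "\<not> ?td A m"
        have "m \<in> E \<rightarrow> carrier K" using mS SK by blast
        hence bad: "\<exists>a. ?bad m a" using nd td_rows[of A m] by blast
        have "\<forall>e. \<exists>t. m e = ?v t" using mS unfolding S_def by blast
        then obtain g where g: "\<And>e. m e = ?v (g e)" by metis
        hence mg: "m = (\<lambda>e. ?v (g e))" by blast
        have "g \<in> G" using bad by (simp add: G_def mg)
        hence "w m \<in> p ` A'" using p_row[of g] by (force simp: A'_def mg)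
        hence "?td {w m} m" using m td_rows[of "p ` A'" m] by blast
        thus False using w[OF bad] by blast
      qed
      moreover have "\<forall>e\<in>E - I. m e = \<zero>\<^bsub>K\<^esub>" using l(2) \<phi>h[OF zS] by (simp add: m_def zK')
      ultimately have m0: "\<forall>e\<in>E. m e = \<zero>\<^bsub>K\<^esub>" using ind unfolding thinly_indep_def by blast
      show ?thesis
      proof
        fix e assume e: "e \<in> E"
        then obtain x where x: "x \<in> S" "l e = h x" using lc carK' by blast
        have "m e = x" using e x \<phi>h[OF x(1)] by (simp add: m_def)
        hence "x = \<zero>\<^bsub>K\<^esub>" using m0 e by simp
        thus "l e = \<zero>\<^bsub>K'\<^esub>" using x zK' by simp
      qed
    qed
    thus "I \<in> thinly_indep K' A' E f'" using IE unfolding thinly_indep_def by blast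
  qed
  moreover have "thinly_indep K' A' E f' \<subseteq> Pow E" "thinly_indep K A E f \<subseteq> Pow E"
    by (auto simp: thinly_indep_def)
  ultimately have "\<I> = thinly_indep K' A' E f'" unfolding \<I> by blast
  hence "is_thin_sums_matroid_of K' A' E f' \<I>"
    using K' f' M by (simp add: is_thin_sums_matroid_of_def)
  thus ?thesis unfolding thin_sums_matroid_def thin_sums_matroid_over_def by blast
qed

end

theory Submission
  imports Defs "HOL-Algebra.Algebraic_Closure_Type"
begin

text \<open>Let \<open>M\<close> be the finite cycle matroid of the infinite fan (a ray together with an apex joined to
  all its vertices), and let \<open>N\<close> be its truncation, with bases \<open>B - e\<close> for \<open>B\<close> a spanning tree.

  In a thin sums representation of \<open>N\<close>, every row meets each circuit finitely. The set of
  spokes and the ray with one end spoke are spanning trees, hence circuits of \<open>N\<close>, so all rows are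
  finite. But then arbitrary infinite combinations of the dependences on the triangles are thin
  dependences, and a telescoping one is supported on a proper subset of a spanning tree, which is
  independent in \<open>N\<close>.

  The dual of \<open>N\<close> is represented over the rationals by the cut space of the fan, restricted to
  eventually constant potentials on the ray and to the kernel of one further functional that is
  nonzero on every bond.\<close>

section \<open>Duality is an involution\<close>

lemma (in matroid) indep_subset_base:
  assumes "I \<in> \<I>"
  obtains B where "B \<in> bases \<I>" "I \<subseteq> B"
proof -
  obtain B where B: "B \<in> bases \<I>" using bases_nonempty by blast
  have "I \<subseteq> E" using assms indep_subset by blast
  then obtain J where "J \<in> bases \<I>" "I \<subseteq> J"
    using extend_in_spanning[OF assms _ order_refl B base_subset[OF B]] by blast
  thus ?thesis by (rule that)
qed

text \<open>Complementing the bases twice restores them, and a matroid is determined by its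
  bases.\<close>

lemma (in matroid) dual_indep_dual_indep: "dual_indep E (dual_indep E \<I>) = \<I>"
proof -
  have "W \<in> dual_indep E (dual_indep E \<I>) \<longleftrightarrow> (\<exists>B\<in>bases \<I>. W \<subseteq> B)" for W
    unfolding dual_indep_def[of E "dual_indep E \<I>"] bases_dual
    using base_subset by (auto simp: double_diff)
  moreover have "W \<in> \<I> \<longleftrightarrow> (\<exists>B\<in>bases \<I>. W \<subseteq> B)" for W
    using indep_subset_base[of W] I2[OF base_indep] by metis
  ultimately show ?thesis by blast
qed

section \<open>Truncations of representable matroids\<close>

lemma (in vector_space) subset_span_trans:
  "V \<subseteq> span T \<Longrightarrow> T \<subseteq> span S \<Longrightarrow> V \<subseteq> span S"
  using span_minimal[OF _ subspace_span] by blast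

text \<open>Exchange: expressing \<open>x\<close> needs \<open>u\<close> with a nonzero coefficient,
  so \<open>u\<close> can be solved for.\<close>

lemma (in vector_space) span_exchange:
  assumes "V \<subseteq> span (insert u S)" "x \<in> V" "x \<notin> span S"
  shows "V \<subseteq> span (insert x S)"
proof -
  have "u \<in> span (insert x S)" using in_span_insert[of x u S] assms by blast
  hence "insert u S \<subseteq> span (insert x S)" using span_superset[of "insert x S"] by blast
  with assms(1) show ?thesis by (rule subset_span_trans)
qed

text \<open>Injectivity lets independence of an indexed family be read off its set of vectors; a
  nonzero vector makes the empty set non-spanning.\<close>

locale vector_family = vector_space scale
  for scale :: "'a::field \<Rightarrow> 'b::ab_group_add \<Rightarrow> 'b" +
  fixes E :: "'e set" and \<phi> :: "'e \<Rightarrow> 'b"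
  assumes inj: "inj_on \<phi> E" and nonzero: "\<not> \<phi> ` E \<subseteq> {0}"
begin

text \<open>Discarding the spanning sets lowers the rank by one without mentioning the rank, which
  may be infinite.\<close>

definition truncated_indep :: "'e set set" where
  "truncated_indep = {I. I \<subseteq> E \<and> independent (\<phi> ` I) \<and> \<not> \<phi> ` E \<subseteq> span (\<phi> ` I)}"

lemma truncated_indep_subset:
  assumes "I \<in> truncated_indep" "J \<subseteq> I"
  shows "J \<in> truncated_indep"
proof -
  have "\<phi> ` J \<subseteq> \<phi> ` I" using assms(2) by blast
  thus ?thesis
    using assms independent_mono[of "\<phi> ` I" "\<phi> ` J"] span_mono[of "\<phi> ` J" "\<phi> ` I"]
    unfolding truncated_indep_def by blast
qed

lemma truncated_indep_insert_notin_span: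
  assumes "insert x I \<in> truncated_indep" "x \<notin> I"
  shows "\<phi> x \<notin> span (\<phi> ` I)"
proof -
  have "insert x I \<subseteq> E" using assms(1) by (auto simp: truncated_indep_def)
  hence "\<phi> x \<notin> \<phi> ` I" using inj assms(2) by (meson inj_on_image_mem_iff insert_subset)
  thus ?thesis using assms(1) by (auto simp: truncated_indep_def independent_insert)
qed

text \<open>An element of \<open>Y\<close> outside \<open>B\<close> is not in the span of
  \<open>B\<close>, so by exchange it can replace \<open>u\<close>; then \<open>B\<close> with this
  element is spanning, which no subset of \<open>Y\<close> can be.\<close>

lemma truncated_indep_maximal:
  assumes u: "\<phi> ` E \<subseteq> span (insert u (\<phi> ` B))" and Y: "Y \<in> truncated_indep" "B \<subseteq> Y"
  shows "Y = B"
proof (rule ccontr)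
  assume "Y \<noteq> B"
  then obtain y where y: "y \<in> Y" "y \<notin> B" using Y by blast
  have yB: "insert y B \<in> truncated_indep" using truncated_indep_subset[OF Y(1)] y Y by blast
  have "\<phi> y \<notin> span (\<phi> ` B)" using truncated_indep_insert_notin_span[OF yB y(2)] .
  moreover have "\<phi> y \<in> \<phi> ` E" using yB by (auto simp: truncated_indep_def)
  ultimately have "\<phi> ` E \<subseteq> span (\<phi> ` insert y B)" using span_exchange[OF u] by simp
  thus False using yB by (simp add: truncated_indep_def)
qed

lemma truncated_indep_spanning_insert:
  assumes "I \<in> truncated_indep" "e \<in> E" "\<phi> e \<notin> span (\<phi> ` I)" "insert e I \<notin> truncated_indep"
  shows "\<phi> ` E \<subseteq> span (insert (\<phi> e) (\<phi> ` I))"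
  using assms independent_insertI[of "\<phi> e" "\<phi> ` I"] by (simp add: truncated_indep_def)

lemma maximal_truncated_indep_hyperplane:
  assumes "maximal_in truncated_indep B"
  obtains u where "\<phi> ` E \<subseteq> span (insert u (\<phi> ` B))"
proof -
  have BJ: "B \<in> truncated_indep" and max: "\<And>Y. Y \<in> truncated_indep \<Longrightarrow> B \<subseteq> Y \<Longrightarrow> Y = B"
    using assms by (auto simp: maximal_in_def)
  obtain e where e: "e \<in> E" "\<phi> e \<notin> span (\<phi> ` B)"
    using BJ by (auto simp: truncated_indep_def)
  hence "e \<notin> B" using span_base[of "\<phi> e" "\<phi> ` B"] by blast
  hence "insert e B \<notin> truncated_indep" using max[of "insert e B"] by blast
  from truncated_indep_spanning_insert[OF BJ e this] show ?thesis by (rule that)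
qed

sublocale truncation: matroid E truncated_indep
proof (rule matroid.intro)
  let ?J = "truncated_indep"
  show "?J \<subseteq> Pow E" by (auto simp: truncated_indep_def)
  show "{} \<in> ?J" using nonzero by (auto simp: truncated_indep_def independent_empty)
  show "J \<in> ?J" if "I \<in> ?J" "J \<subseteq> I" for I J
    using that by (rule truncated_indep_subset)
  show "\<exists>x\<in>I' - I. insert x I \<in> ?J"
    if I: "I \<in> ?J" and I': "maximal_in ?J I'" and nmax: "\<not> maximal_in ?J I" for I I'
  proof (rule ccontr)
    assume no: "\<not> (\<exists>x\<in>I' - I. insert x I \<in> ?J)"
    \<comment> \<open>If \<open>I\<close> spans \<open>I'\<close>, it spans at least a hyperplane;
      otherwise some element of \<open>I'\<close> outside its span makes it spanning. Either way
      \<open>I\<close> is maximal.\<close>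
    have "\<exists>u. \<phi> ` E \<subseteq> span (insert u (\<phi> ` I))"
    proof (cases "\<phi> ` I' \<subseteq> span (\<phi> ` I)")
      case True
      obtain u where "\<phi> ` E \<subseteq> span (insert u (\<phi> ` I'))"
        using maximal_truncated_indep_hyperplane[OF I'] .
      moreover have "insert u (\<phi> ` I') \<subseteq> span (insert u (\<phi> ` I))"
        using True span_mono[of "\<phi> ` I" "insert u (\<phi> ` I)"]
          span_superset[of "insert u (\<phi> ` I)"] by blast
      ultimately show ?thesis using subset_span_trans by blast
    next
      case False
      then obtain y where y: "y \<in> I'" "\<phi> y \<notin> span (\<phi> ` I)" by blast
      hence "y \<in> I' - I" using span_base[of "\<phi> y" "\<phi> ` I"] by blast
      moreover have "I' \<subseteq> E" using I' by (auto simp: maximal_in_def truncated_indep_def)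
      ultimately show ?thesis using truncated_indep_spanning_insert[OF I _ y(2)] no by blast
    qed
    then obtain u where u: "\<phi> ` E \<subseteq> span (insert u (\<phi> ` I))" by blast
    have "maximal_in ?J I"
      using I truncated_indep_maximal[OF u] unfolding maximal_in_def by blast
    thus False using nmax by blast
  qed
  show "\<exists>M. maximal_in {I' \<in> ?J. I \<subseteq> I' \<and> I' \<subseteq> W} M"
    if IW: "I \<subseteq> W" "W \<subseteq> E" and I: "I \<in> ?J" for I W
  proof -
    have ind: "independent (\<phi> ` I)" using I by (simp add: truncated_indep_def)
    obtain B where B: "\<phi> ` I \<subseteq> B" "B \<subseteq> \<phi> ` W" "independent B" "\<phi> ` W \<subseteq> span B"
      using maximal_independent_subset_extend[OF image_mono[OF IW(1)] ind] .
    define C where "C = {x \<in> W. \<phi> x \<in> B}"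
    have \<phi>C: "\<phi> ` C = B" and IC: "I \<subseteq> C" and CW: "C \<subseteq> W"
      using B IW by (auto simp: C_def)
    have injW: "inj_on \<phi> W" using inj IW inj_on_subset by blast
    show ?thesis
    proof (cases "\<phi> ` E \<subseteq> span B")
      case False
      hence CJ: "C \<in> ?J" using B CW IW by (auto simp: truncated_indep_def \<phi>C)
      have "Y = C" if Y: "Y \<in> ?J" "Y \<subseteq> W" "C \<subseteq> Y" for Y
      proof (rule ccontr)
        assume "Y \<noteq> C"
        then obtain y where y: "y \<in> Y" "y \<notin> C" using Y by blast
        have "insert y C \<in> ?J" using truncated_indep_subset[OF Y(1)] y Y by blast
        hence "\<phi> y \<notin> span B" using truncated_indep_insert_notin_span[of y C] y \<phi>C by simp
        thus False using B y Y by blast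
      qed
      thus ?thesis using CJ IC CW by (intro exI[of _ C]) (auto simp: maximal_in_def)
    next
      case True
      \<comment> \<open>Here the basis \<open>C\<close> is one element too large. As
        \<open>I\<close> is not spanning, the element to drop can be taken outside
        \<open>I\<close>.\<close>
      hence "C \<noteq> I" using I \<phi>C by (auto simp: truncated_indep_def)
      then obtain e where e: "e \<in> C" "e \<notin> I" using IC by blast
      let ?D = "C - {e}"
      have \<phi>D: "insert (\<phi> e) (\<phi> ` ?D) = B" using e \<phi>C by blast
      have "\<phi> e \<notin> \<phi> ` ?D" using e CW inj_onD[OF injW, of e] by auto
      hence "\<phi> e \<notin> span (\<phi> ` ?D)" and "independent (\<phi> ` ?D)"
        using B(3) independent_insert[of "\<phi> e" "\<phi> ` ?D"] unfolding \<phi>D by simp_all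
      moreover have "\<phi> e \<in> \<phi> ` E" using e CW IW by blast
      ultimately have DJ: "?D \<in> ?J" using CW IW unfolding truncated_indep_def by blast
      have "Y = ?D" if "Y \<in> ?J" "?D \<subseteq> Y" for Y
        using truncated_indep_maximal[of "\<phi> e" ?D Y] that True \<phi>D by simp
      thus ?thesis using DJ IC CW e by (intro exI[of _ ?D]) (auto simp: maximal_in_def)
    qed
  qed
qed

text \<open>This exhibits members of the dual. A maximal truncated independent subset of
  \<open>Z\<close> is a base: either it spans \<open>Z\<close>, or an element of \<open>Z\<close>
  outside its span makes it spanning.\<close>

lemma base_in_hyperplane:
  assumes "Z \<subseteq> E" "\<phi> ` E \<subseteq> span (insert u (\<phi> ` Z))"
  obtains B where "B \<in> bases truncated_indep" "B \<subseteq> Z"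
proof -
  obtain B where "maximal_in {I' \<in> truncated_indep. {} \<subseteq> I' \<and> I' \<subseteq> Z} B"
    using truncation.IM[OF _ assms(1) truncation.I1] by blast
  hence BJ: "B \<in> truncated_indep" "B \<subseteq> Z"
    and max: "\<And>Y. Y \<in> truncated_indep \<Longrightarrow> Y \<subseteq> Z \<Longrightarrow> B \<subseteq> Y \<Longrightarrow> Y = B"
    by (auto simp: maximal_in_def)
  have "\<exists>v. \<phi> ` E \<subseteq> span (insert v (\<phi> ` B))"
  proof (cases "\<phi> ` Z \<subseteq> span (\<phi> ` B)")
    case True
    hence "insert u (\<phi> ` Z) \<subseteq> span (insert u (\<phi> ` B))"
      using span_mono[of "\<phi> ` B" "insert u (\<phi> ` B)"] span_superset[of "insert u (\<phi> ` B)"]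
      by blast
    thus ?thesis using assms(2) subset_span_trans by blast
  next
    case False
    then obtain z where z: "z \<in> Z" "\<phi> z \<notin> span (\<phi> ` B)" by blast
    hence "z \<notin> B" using span_base[of "\<phi> z" "\<phi> ` B"] by blast
    hence "insert z B \<notin> truncated_indep" using max[of "insert z B"] z BJ by blast
    thus ?thesis using truncated_indep_spanning_insert[OF BJ(1) _ z(2)] z(1) assms(1) by blast
  qed
  then obtain v where v: "\<phi> ` E \<subseteq> span (insert v (\<phi> ` B))" by blast
  hence "B \<in> bases truncated_indep"
    using BJ truncated_indep_maximal unfolding bases_def maximal_in_def by blast
  thus ?thesis using that BJ by blast
qed

end

section \<open>Thin dependences\<close>

lemma finsum_support:
  assumes "ring K" "\<And>e. e \<in> E \<Longrightarrow> g e \<in> carrier K" "finite T" "T \<subseteq> E"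
    and "\<And>e. e \<in> E - T \<Longrightarrow> g e = \<zero>\<^bsub>K\<^esub>"
  shows "(\<Oplus>\<^bsub>K\<^esub>e\<in>{e \<in> E. g e \<noteq> \<zero>\<^bsub>K\<^esub>}. g e) = (\<Oplus>\<^bsub>K\<^esub>e\<in>T. g e)"
proof -
  interpret ring K by fact
  show ?thesis
    using assms(2-5) by (intro add.finprod_mono_neutral_cong_left) auto
qed

lemma thin_dependence_finsum:
  assumes "ring K" "f \<in> E \<rightarrow> A \<rightarrow> carrier K" "thin_dependence K A E f l" "a \<in> A"
    and "finite T" "T \<subseteq> E" "\<And>e. e \<in> E - T \<Longrightarrow> l e = \<zero>\<^bsub>K\<^esub>"
  shows "(\<Oplus>\<^bsub>K\<^esub>e\<in>T. l e \<otimes>\<^bsub>K\<^esub> f e a) = \<zero>\<^bsub>K\<^esub>"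
proof -
  interpret ring K by fact
  have fc: "f e a \<in> carrier K" if "e \<in> E" for e using assms(2,4) that by blast
  have lc: "l e \<in> carrier K" if "e \<in> E" for e
    using assms(3) that unfolding thin_dependence_def by blast
  have "(\<Oplus>\<^bsub>K\<^esub>e\<in>{e \<in> E. l e \<otimes>\<^bsub>K\<^esub> f e a \<noteq> \<zero>\<^bsub>K\<^esub>}. l e \<otimes>\<^bsub>K\<^esub> f e a) = (\<Oplus>\<^bsub>K\<^esub>e\<in>T. l e \<otimes>\<^bsub>K\<^esub> f e a)"
    using assms(5-7) fc lc by (intro finsum_support[OF assms(1)]) auto
  thus ?thesis using assms(3,4) by (simp add: thin_dependence_def)
qed

text \<open>A dependence on \<open>C\<close> vanishing at \<open>e\<close> is one on
  \<open>C - {e}\<close>, hence zero if that set is independent.\<close>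

lemma thinly_dependent_obtain:
  assumes "C \<subseteq> E" "C \<notin> thinly_indep K A E f"
  obtains l where "thin_dependence K A E f l" "\<And>e. e \<in> E - C \<Longrightarrow> l e = \<zero>\<^bsub>K\<^esub>"
    "\<And>e. e \<in> C \<Longrightarrow> C - {e} \<in> thinly_indep K A E f \<Longrightarrow> l e \<noteq> \<zero>\<^bsub>K\<^esub>"
proof -
  obtain l where l: "thin_dependence K A E f l" "\<forall>e\<in>E - C. l e = \<zero>\<^bsub>K\<^esub>"
    and nz: "\<not> (\<forall>e\<in>E. l e = \<zero>\<^bsub>K\<^esub>)"
    using assms unfolding thinly_indep_def by blast
  have "l e \<noteq> \<zero>\<^bsub>K\<^esub>" if e: "e \<in> C" "C - {e} \<in> thinly_indep K A E f" for e
  proof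
    assume "l e = \<zero>\<^bsub>K\<^esub>"
    hence "\<forall>d\<in>E - (C - {e}). l d = \<zero>\<^bsub>K\<^esub>" using l by blast
    thus False using e(2) l(1) nz unfolding thinly_indep_def by blast
  qed
  thus ?thesis using that l by blast
qed

text \<open>Such a \<open>C\<close> is a circuit, so its dependence is nonzero on all of it, and
  thinness of the dependence at \<open>a\<close> becomes finiteness of the row itself on
  \<open>C\<close>.\<close>

lemma finite_row_circuit:
  assumes "field K" "f \<in> E \<rightarrow> A \<rightarrow> carrier K" "a \<in> A"
    and "C \<subseteq> E" "C \<notin> thinly_indep K A E f"
    and "\<And>e. e \<in> C \<Longrightarrow> C - {e} \<in> thinly_indep K A E f"
  shows "finite {e \<in> C. f e a \<noteq> \<zero>\<^bsub>K\<^esub>}"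
proof -
  interpret field K by fact
  obtain l where l: "thin_dependence K A E f l" "\<And>e. e \<in> C \<Longrightarrow> l e \<noteq> \<zero>\<^bsub>K\<^esub>"
    using thinly_dependent_obtain[OF assms(4,5)] assms(6) by metis
  have lc: "l e \<in> carrier K" if "e \<in> E" for e
    using l that unfolding thin_dependence_def by blast
  have "f e a \<in> carrier K" if "e \<in> E" for e using assms(2,3) that by blast
  hence "{e \<in> C. f e a \<noteq> \<zero>\<^bsub>K\<^esub>} \<subseteq> {e \<in> E. l e \<otimes>\<^bsub>K\<^esub> f e a \<noteq> \<zero>\<^bsub>K\<^esub>}"
    using lc l(2) assms(4) integral by blast
  thus ?thesis
    using l(1) assms(3) finite_subset unfolding thin_dependence_def by blast
qed

section \<open>The truncated cycle matroid of the fan is not a thin sums matroid\<close>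

text \<open>The spokes of the fan are the even numbers and the rim edges, which form a ray, are the odd
  numbers: the edge \<open>Suc (2 * i)\<close> joins the rim ends of the spokes \<open>2 * i\<close> and \<open>2 * Suc i\<close>.\<close>

text \<open>The two circuits force all rows to be finite. Hence an infinite combination of dependences
  on the triangles that cancels all spokes but the second is again a thin dependence.\<close>

lemma fan_ray_thinly_dependent:
  fixes f :: "nat \<Rightarrow> 'a \<Rightarrow> 'k" and A :: "'a set" and K (structure)
  defines "\<J> \<equiv> thinly_indep K A UNIV f"
  assumes K: "field K" and f: "f \<in> UNIV \<rightarrow> A \<rightarrow> carrier K"
    and spokes: "range (\<lambda>i. 2 * i) \<notin> \<J>" "\<And>e. e \<in> range (\<lambda>i. 2 * i) \<Longrightarrow> range (\<lambda>i. 2 * i) - {e} \<in> \<J>"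
    and ray: "insert 0 (range (\<lambda>i. Suc (2 * i))) \<notin> \<J>"
      "\<And>e. e \<in> insert 0 (range (\<lambda>i. Suc (2 * i))) \<Longrightarrow> insert 0 (range (\<lambda>i. Suc (2 * i))) - {e} \<in> \<J>"
    and triangle: "\<And>i. {2 * i, Suc (2 * i), 2 * Suc i} \<notin> \<J>" "\<And>i. {Suc (2 * i), 2 * Suc i} \<in> \<J>"
  shows "insert 2 (range (\<lambda>i. Suc (2 * Suc i))) \<notin> \<J>"
proof -
  interpret field K by fact
  have fc[simp]: "f e a \<in> carrier K" if "a \<in> A" for e a using f that by blast
  have fin: "finite {e. f e a \<noteq> \<zero>}" if "a \<in> A" for a
  proof -
    have "finite {e \<in> range (\<lambda>i. 2 * i). f e a \<noteq> \<zero>}"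
      "finite {e \<in> insert 0 (range (\<lambda>i. Suc (2 * i))). f e a \<noteq> \<zero>}"
      using finite_row_circuit[OF K f that, of "range (\<lambda>i. 2 * i)"] spokes
        finite_row_circuit[OF K f that, of "insert 0 (range (\<lambda>i. Suc (2 * i)))"] ray
      unfolding \<J>_def by auto
    moreover have "{e. f e a \<noteq> \<zero>} \<subseteq> {e \<in> range (\<lambda>i. 2 * i). f e a \<noteq> \<zero>}
        \<union> {e \<in> insert 0 (range (\<lambda>i. Suc (2 * i))). f e a \<noteq> \<zero>}"
    proof
      fix e assume "e \<in> {e. f e a \<noteq> \<zero>}"
      moreover have "e \<in> range (\<lambda>i. 2 * i) \<or> e \<in> range (\<lambda>i. Suc (2 * i))"
        by (cases "even e") (auto elim!: evenE oddE)
      ultimately show "e \<in> {e \<in> range (\<lambda>i. 2 * i). f e a \<noteq> \<zero>}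
        \<union> {e \<in> insert 0 (range (\<lambda>i. Suc (2 * i))). f e a \<noteq> \<zero>}" by blast
    qed
    ultimately show ?thesis using finite_subset by blast
  qed
  \<comment> \<open>Independence of the other two edges makes the dependence on triangle
    \<open>i\<close> nonzero at its first spoke, so that coefficient can be inverted.\<close>
  have "\<exists>d. thin_dependence K A UNIV f d \<and> (\<forall>e. e \<notin> {2 * i, Suc (2 * i), 2 * Suc i} \<longrightarrow> d e = \<zero>)
      \<and> d (2 * i) \<noteq> \<zero>" for i
  proof -
    have "{2 * i, Suc (2 * i), 2 * Suc i} - {2 * i} = {Suc (2 * i), 2 * Suc i}" by auto
    thus ?thesis
      using thinly_dependent_obtain[of "{2 * i, Suc (2 * i), 2 * Suc i}" UNIV K A f]
        triangle[of i] unfolding \<J>_def by (metis Diff_iff UNIV_I insertI1 top_greatest)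
  qed
  then obtain d where d: "\<And>i. thin_dependence K A UNIV f (d i)"
    and d0: "\<And>i e. e \<notin> {2 * i, Suc (2 * i), 2 * Suc i} \<Longrightarrow> d i e = \<zero>"
    and dnz: "\<And>i. d i (2 * i) \<noteq> \<zero>" by metis
  have dc[simp]: "d i e \<in> carrier K" for i e using d[of i] by (auto simp: thin_dependence_def)
  have dsum: "d i (2 * i) \<otimes> f (2 * i) a \<oplus> d i (Suc (2 * i)) \<otimes> f (Suc (2 * i)) a
      = \<ominus> (d i (2 * Suc i) \<otimes> f (2 * Suc i) a)" if a: "a \<in> A" for i a
  proof -
    have "(\<Oplus>e\<in>{2 * i, Suc (2 * i), 2 * Suc i}. d i e \<otimes> f e a) = \<zero>"
      using d0 by (intro thin_dependence_finsum[OF ring_axioms f d a]) auto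
    hence "d i (2 * i) \<otimes> f (2 * i) a \<oplus> (d i (Suc (2 * i)) \<otimes> f (Suc (2 * i)) a
        \<oplus> d i (2 * Suc i) \<otimes> f (2 * Suc i) a) = \<zero>"
      using a by (simp add: finsum_insert)
    thus ?thesis using a by (simp add: add.m_assoc[symmetric] minus_equality[symmetric])
  qed
  \<comment> \<open>The multiplier \<open>m i\<close> belongs to triangle \<open>Suc i\<close>,
    chosen so that consecutive triangles cancel on their common spoke. Leaving out triangle
    \<open>0\<close> keeps the edges \<open>0\<close> and \<open>1\<close> out of the
    support.\<close>
  define m where "m = rec_nat \<one> (\<lambda>i c. \<ominus> (c \<otimes> d (Suc i) (2 * Suc (Suc i)))
      \<otimes> inv (d (Suc (Suc i)) (2 * Suc (Suc i))))"
  have inv_d: "inv (d i (2 * i)) \<in> carrier K" "inv (d i (2 * i)) \<otimes> d i (2 * i) = \<one>" for i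
    using dnz[of i] field_Units by (auto intro: Units_l_inv)
  have mc[simp]: "m i \<in> carrier K" for i
    using inv_d(1)[of "Suc (Suc _)"] by (induction i) (auto simp: m_def)
  have m_Suc: "m (Suc i) \<otimes> d (Suc (Suc i)) (2 * Suc (Suc i))
      = \<ominus> (m i \<otimes> d (Suc i) (2 * Suc (Suc i)))" for i
  proof -
    have "m (Suc i) = \<ominus> (m i \<otimes> d (Suc i) (2 * Suc (Suc i)))
        \<otimes> inv (d (Suc (Suc i)) (2 * Suc (Suc i)))" by (simp add: m_def)
    thus ?thesis using inv_d[of "Suc (Suc i)"] by (simp add: m_assoc del: mult_Suc_right)
  qed
  \<comment> \<open>The formal sum of the multiplied triangle dependences after cancellation. The
    entry at \<open>2\<close> uses that \<open>m 0\<close> is one, and \<open>e div 2 - 1\<close>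
    undoes the index shift.\<close>
  define l where "l e = (if e = 2 then d 1 2
      else if odd e \<and> e \<noteq> 1 then m (e div 2 - 1) \<otimes> d (e div 2) e else \<zero>)" for e
  have lc[simp]: "l e \<in> carrier K" for e by (simp add: l_def)
  have l_rim: "l (Suc (2 * Suc i)) = m i \<otimes> d (Suc i) (Suc (2 * Suc i))" for i
    by (simp add: l_def)
  let ?T = "\<lambda>n. insert 2 ((\<lambda>i. Suc (2 * Suc i)) ` {..<n})"
  \<comment> \<open>By telescoping, each partial sum collapses to one boundary term at the spoke
    \<open>2 * Suc n\<close>.\<close>
  have partial: "(\<Oplus>e\<in>?T n. l e \<otimes> f e a)
      = m n \<otimes> d (Suc n) (2 * Suc n) \<otimes> f (2 * Suc n) a" if a: "a \<in> A" for a n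
  proof (induction n)
    case 0
    show ?case using a by (simp add: m_def l_def numeral_2_eq_2)
  next
    case (Suc n)
    let ?o = "2 * Suc n" and ?z = "Suc (2 * Suc n)"
    have "?T (Suc n) = insert ?z (?T n)" by (auto simp: lessThan_Suc)
    moreover have "?z \<notin> ?T n" by auto
    ultimately have "(\<Oplus>e\<in>?T (Suc n). l e \<otimes> f e a)
        = l ?z \<otimes> f ?z a \<oplus> m n \<otimes> d (Suc n) ?o \<otimes> f ?o a"
      using a Suc.IH by (simp add: finsum_insert del: mult_Suc_right)
    also have "\<dots> = m n \<otimes> (d (Suc n) ?o \<otimes> f ?o a \<oplus> d (Suc n) ?z \<otimes> f ?z a)"
      using a by (simp add: l_rim r_distr m_assoc a_comm del: mult_Suc_right)
    also have "\<dots> = \<ominus> (m n \<otimes> d (Suc n) (2 * Suc (Suc n))) \<otimes> f (2 * Suc (Suc n)) a"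
      using a by (simp add: dsum r_minus l_minus m_assoc del: mult_Suc_right)
    also have "\<dots> = m (Suc n) \<otimes> d (Suc (Suc n)) (2 * Suc (Suc n)) \<otimes> f (2 * Suc (Suc n)) a"
      by (simp only: m_Suc)
    finally show ?case .
  qed
  have l0: "l e = \<zero>" if "e \<notin> insert 2 (range (\<lambda>i. Suc (2 * Suc i)))" for e
  proof (cases "odd e \<and> e \<noteq> 1")
    case True
    then obtain i where "e = Suc (2 * i)" "i \<noteq> 0" by (auto elim!: oddE)
    hence "e = Suc (2 * Suc (i - 1))" by simp
    thus ?thesis using that by blast
  qed (use that in \<open>auto simp: l_def\<close>)
  have "thin_dependence K A UNIV f l" unfolding thin_dependence_def
  proof (intro conjI ballI)
    show "l \<in> UNIV \<rightarrow> carrier K" by simp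
    fix a assume a: "a \<in> A"
    have "{e. l e \<otimes> f e a \<noteq> \<zero>} \<subseteq> {e. f e a \<noteq> \<zero>}" using a by auto
    thus "finite {e \<in> UNIV. l e \<otimes> f e a \<noteq> \<zero>}" using fin[OF a] finite_subset by simp
    obtain n where n: "\<And>e. f e a \<noteq> \<zero> \<Longrightarrow> e < n"
      using fin[OF a] finite_nat_set_iff_bounded by auto
    have "l e \<otimes> f e a = \<zero>" if "e \<notin> ?T n" for e
    proof (cases "e < n")
      case True
      hence "e \<notin> insert 2 (range (\<lambda>i. Suc (2 * Suc i)))" using that by auto
      thus ?thesis using l0 a by simp
    next
      case False
      hence "f e a = \<zero>" using n by blast
      thus ?thesis by simp
    qed
    hence "(\<Oplus>e\<in>{e \<in> UNIV. l e \<otimes> f e a \<noteq> \<zero>}. l e \<otimes> f e a) = (\<Oplus>e\<in>?T n. l e \<otimes> f e a)"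
      using a by (intro finsum_support[OF ring_axioms]) auto
    also have "\<dots> = m n \<otimes> d (Suc n) (2 * Suc n) \<otimes> f (2 * Suc n) a" by (rule partial[OF a])
    \<comment> \<open>The boundary term dies because row \<open>a\<close> ends before
      \<open>n\<close>.\<close>
    also have "f (2 * Suc n) a = \<zero>" using n[of "2 * Suc n"] by fastforce
    also have "m n \<otimes> d (Suc n) (2 * Suc n) \<otimes> \<zero> = \<zero>" by simp
    finally show "(\<Oplus>e\<in>{e \<in> UNIV. l e \<otimes> f e a \<noteq> \<zero>}. l e \<otimes> f e a) = \<zero>" .
  qed
  moreover have "l 2 \<noteq> \<zero>" using dnz[of 1] by (simp add: l_def)
  ultimately show ?thesis using l0 unfolding \<J>_def thinly_indep_def by blast
qed

section \<open>The dual of the truncated cycle matroid of the fan\<close>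

text \<open>The rim vertex of the spoke \<open>2 * i\<close> is the unit vector \<open>monom 1 i\<close>, the apex is \<open>0\<close>, and an
  edge is the difference of its ends.\<close>

definition fan_edge :: "nat \<Rightarrow> rat poly" where
  "fan_edge e = (if even e then monom 1 (e div 2)
                 else monom 1 (e div 2) - monom 1 (Suc (e div 2)))"

lemma fan_edge_spoke [simp]: "fan_edge (2 * i) = monom 1 i"
  and fan_edge_rim [simp]: "fan_edge (Suc (2 * i)) = monom 1 i - monom 1 (Suc i)"
  by (simp_all add: fan_edge_def)

lemma fan_edge_cases [case_names spoke rim]:
  obtains i where "e = 2 * i" | i where "e = Suc (2 * i)"
  by (cases "even e") (auto elim!: evenE oddE)

lemma inj_fan_edge: "inj fan_edge"
proof (rule injI)
  fix d e assume eq: "fan_edge d = fan_edge e"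
  have c: "coeff (fan_edge d) n = coeff (fan_edge e) n" for n using eq by simp
  show "d = e"
  proof (cases d rule: fan_edge_cases; cases e rule: fan_edge_cases)
    fix i j assume "d = 2 * i" "e = 2 * j"
    thus ?thesis using c[of i] by (simp split: if_splits)
  next
    fix i j assume "d = 2 * i" "e = Suc (2 * j)"
    thus ?thesis using c[of "Suc j"] by (simp split: if_splits)
  next
    fix i j assume "d = Suc (2 * i)" "e = 2 * j"
    thus ?thesis using c[of "Suc i"] by (simp split: if_splits)
  next
    fix i j assume "d = Suc (2 * i)" "e = Suc (2 * j)"
    thus ?thesis using c[of i] c[of "Suc i"] by (simp split: if_splits)
  qed
qed

interpretation fan: vector_family "smult :: rat \<Rightarrow> rat poly \<Rightarrow> rat poly" UNIV fan_edge
proof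
  have "fan_edge 0 \<noteq> 0" by (simp add: fan_edge_def)
  thus "\<not> range fan_edge \<subseteq> {0}" by blast
qed (simp_all add: inj_fan_edge smult_add_right smult_add_left)

text \<open>The cut functional of a potential \<open>x\<close> on the rim vertices, the apex having potential \<open>0\<close>.\<close>

definition cut :: "(nat \<Rightarrow> rat) \<Rightarrow> rat poly \<Rightarrow> rat" where
  "cut x p = (\<Sum>k\<le>degree p. x k * coeff p k)"

lemma cut_eq_sum: "degree p \<le> n \<Longrightarrow> cut x p = (\<Sum>k\<le>n. x k * coeff p k)"
  unfolding cut_def by (rule sum.mono_neutral_left) (auto simp: coeff_eq_0)

lemma cut_0 [simp]: "cut x 0 = 0"
  by (simp add: cut_def)

lemma cut_add [simp]: "cut x (p + q) = cut x p + cut x q"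
proof -
  let ?n = "max (degree p) (degree q)"
  have "degree (p + q) \<le> ?n" by (rule degree_add_le_max)
  thus ?thesis
    by (simp add: cut_eq_sum[of _ ?n] sum.distrib[symmetric] distrib_left)
qed

lemma cut_smult [simp]: "cut x (smult c p) = c * cut x p"
  using degree_smult_le[of c p]
  by (simp add: cut_eq_sum[of _ "degree p"] sum_distrib_left mult.left_commute)

lemma cut_diff [simp]: "cut x (p - q) = cut x p - cut x q"
  using cut_add[of x p "- q"] cut_smult[of x "- 1" q] by simp

lemma cut_monom [simp]: "cut x (monom 1 k) = x k"
  by (simp add: cut_eq_sum[OF degree_monom_le] if_distrib cong: if_cong)

lemma cut_1 [simp]: "cut x 1 = x 0"
  using cut_monom[of x 0] by (simp add: monom_0 one_pCons)

text \<open>Both sides are linear in \<open>v\<close>. Allowing two potentials passes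
  proportionality of functionals from generators to the span.\<close>

lemma cut_span:
  assumes "v \<in> fan.span S" "\<And>u. u \<in> S \<Longrightarrow> c * cut x u = d * cut y u"
  shows "c * cut x v = d * cut y v"
  using assms(1)
  by (induction rule: fan.span_induct_alt) (auto simp: assms(2) algebra_simps)

lemma cut_span_0:
  assumes "v \<in> fan.span S" "\<And>u. u \<in> S \<Longrightarrow> cut x u = 0"
  shows "cut x v = 0"
  using cut_span[of v S 1 x 0 x] assms by simp

text \<open>A cut meeting \<open>T\<close> only in one edge keeps that edge out of the span of the
  rest, so \<open>T\<close> is independent. Removing \<open>e\<close> guards against
  \<open>T\<close> being spanning.\<close>

lemma cuts_imp_truncated_indep:
  assumes cuts: "\<And>e. e \<in> T \<Longrightarrow> \<exists>x. cut x (fan_edge e) \<noteq> 0 \<and> (\<forall>d\<in>T - {e}. cut x (fan_edge d) = 0)"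
    and e: "e \<in> T"
  shows "T - {e} \<in> fan.truncated_indep"
proof -
  have nspan: "fan_edge d \<notin> fan.span (fan_edge ` (T - {d}))" if "d \<in> T" for d
    using cuts[OF that] cut_span_0[of "fan_edge d" "fan_edge ` (T - {d})"] by blast
  have "fan.independent (fan_edge ` (T - {e}))"
    unfolding fan.dependent_def
  proof (intro notI, elim bexE)
    fix v assume "v \<in> fan_edge ` (T - {e})"
      and v: "v \<in> fan.span (fan_edge ` (T - {e}) - {v})"
    then obtain d where d: "d \<in> T" "v = fan_edge d" by blast
    have "fan_edge ` (T - {e}) - {v} \<subseteq> fan_edge ` (T - {d})" using d by blast
    thus False using nspan[OF d(1)] fan.span_mono v d(2) by blast
  qed
  moreover have "\<not> range fan_edge \<subseteq> fan.span (fan_edge ` (T - {e}))"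
    using nspan[OF e] by blast
  ultimately show ?thesis by (simp add: fan.truncated_indep_def)
qed

lemma fan_spanning:
  assumes "\<And>i. monom 1 i \<in> fan.span S"
  shows "range fan_edge \<subseteq> fan.span S"
proof
  fix v assume "v \<in> range fan_edge"
  then obtain e where "v = fan_edge e" by blast
  thus "v \<in> fan.span S"
    by (cases e rule: fan_edge_cases) (auto intro: fan.span_diff assms)
qed

text \<open>The truncated fan satisfies the hypotheses of \<open>fan_ray_thinly_dependent\<close>
  but not its conclusion. Cuts certify independence; spanning or the triangle relation excludes
  it.\<close>

lemma truncated_fan_not_thin:
  "\<not> thin_sums_matroid UNIV fan.truncated_indep"
proof
  assume "thin_sums_matroid UNIV fan.truncated_indep"
  then obtain K :: "nat universe ring" and A :: "nat universe set" and f
    where K: "field K" and f: "f \<in> UNIV \<rightarrow> A \<rightarrow> carrier K"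
    and eq: "fan.truncated_indep = thinly_indep K A UNIV f"
    unfolding thin_sums_matroid_def thin_sums_matroid_over_def is_thin_sums_matroid_of_def by blast
  \<comment> \<open>All cuts below come from 0-1 potentials, \<open>P\<close> being the side away
    from the apex.\<close>
  define ind :: "(nat \<Rightarrow> bool) \<Rightarrow> nat \<Rightarrow> rat" where "ind P i = (if P i then 1 else 0)" for P i
  have spokes: "range (\<lambda>i. 2 * i) - {e} \<in> fan.truncated_indep"
    if "e \<in> range (\<lambda>i. 2 * i)" for e :: nat
  proof (rule cuts_imp_truncated_indep[OF _ that])
    fix e :: nat assume "e \<in> range (\<lambda>i. 2 * i)"
    then obtain i where "e = 2 * i" by blast
    thus "\<exists>x. cut x (fan_edge e) \<noteq> 0 \<and> (\<forall>d\<in>range (\<lambda>i. 2 * i) - {e}. cut x (fan_edge d) = 0)"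
      by (intro exI[of _ "ind (\<lambda>k. k = i)"]) (auto simp: ind_def split: if_splits)
  qed
  have ray: "insert 0 (range (\<lambda>i. Suc (2 * i))) - {e} \<in> fan.truncated_indep"
    if "e \<in> insert 0 (range (\<lambda>i. Suc (2 * i)))" for e
  proof (rule cuts_imp_truncated_indep[OF _ that])
    fix e assume "e \<in> insert 0 (range (\<lambda>i. Suc (2 * i)))"
    then consider "e = 0" | i where "e = Suc (2 * i)" by blast
    thus "\<exists>x. cut x (fan_edge e) \<noteq> 0
        \<and> (\<forall>d\<in>insert 0 (range (\<lambda>i. Suc (2 * i))) - {e}. cut x (fan_edge d) = 0)"
    proof cases
      case 1
      thus ?thesis using fan_edge_spoke[of 0]
        by (intro exI[of _ "ind (\<lambda>k. True)"]) (auto simp: ind_def split: if_splits)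
    next
      case 2
      thus ?thesis using fan_edge_spoke[of 0]
        by (intro exI[of _ "ind (\<lambda>k. k > i)"]) (auto simp: ind_def split: if_splits)
    qed
  qed
  have spokes': "range (\<lambda>i. 2 * i) \<notin> fan.truncated_indep"
  proof -
    have "monom 1 i \<in> fan.span (fan_edge ` range (\<lambda>i. 2 * i))" for i
      by (rule fan.span_base) (auto simp: image_image)
    thus ?thesis using fan_spanning by (simp add: fan.truncated_indep_def)
  qed
  have ray': "insert 0 (range (\<lambda>i. Suc (2 * i))) \<notin> fan.truncated_indep"
  proof -
    let ?S = "fan_edge ` insert 0 (range (\<lambda>i. Suc (2 * i)))"
    have "monom 1 i \<in> fan.span ?S" for i
    proof (induction i)
      case 0
      show ?case using fan_edge_spoke[of 0] by (intro fan.span_base) auto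
    next
      case (Suc i)
      have "fan_edge (Suc (2 * i)) \<in> fan.span ?S" by (intro fan.span_base) blast
      hence "monom 1 i - fan_edge (Suc (2 * i)) \<in> fan.span ?S" by (rule fan.span_diff[OF Suc.IH])
      thus ?case by simp
    qed
    thus ?thesis using fan_spanning by (simp add: fan.truncated_indep_def)
  qed
  have triangle: "{2 * i, Suc (2 * i), 2 * Suc i} \<notin> fan.truncated_indep" for i
  proof -
    let ?S = "fan_edge ` {2 * i, Suc (2 * i), 2 * Suc i}"
    have "{fan_edge (Suc (2 * i)), fan_edge (2 * Suc i)} \<subseteq> ?S - {fan_edge (2 * i)}"
      by (auto simp: inj_eq[OF inj_fan_edge] simp del: fan_edge_spoke fan_edge_rim mult_Suc_right)
    hence "fan_edge (Suc (2 * i)) + fan_edge (2 * Suc i) \<in> fan.span (?S - {fan_edge (2 * i)})"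
      by (intro fan.span_add fan.span_base) auto
    moreover have "fan_edge (Suc (2 * i)) + fan_edge (2 * Suc i) = fan_edge (2 * i)"
      by (simp del: mult_Suc_right)
    ultimately have "fan.dependent ?S" unfolding fan.dependent_def by (metis imageI insertI1)
    thus ?thesis by (simp add: fan.truncated_indep_def)
  qed
  have pair: "{Suc (2 * i), 2 * Suc i} \<in> fan.truncated_indep" for i
  proof -
    \<comment> \<open>A third edge pads the pair, since \<open>cuts_imp_truncated_indep\<close>
      concludes only about a set with one element removed.\<close>
    let ?T = "{Suc (2 * i), 2 * Suc i, 2 * Suc (Suc i)}"
    have "?T - {2 * Suc (Suc i)} \<in> fan.truncated_indep"
    proof (rule cuts_imp_truncated_indep)
      fix e assume "e \<in> ?T"
      then consider "e = Suc (2 * i)" | "e = 2 * Suc i" | "e = 2 * Suc (Suc i)" by blast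
      thus "\<exists>x. cut x (fan_edge e) \<noteq> 0 \<and> (\<forall>d\<in>?T - {e}. cut x (fan_edge d) = 0)"
      proof cases
        case 1
        thus ?thesis
          by (intro exI[of _ "ind (\<lambda>k. k = i)"]) (auto simp: ind_def split: if_splits simp del: mult_Suc_right)
      next
        case 2
        thus ?thesis by (intro exI[of _ "ind (\<lambda>k. k = i \<or> k = Suc i)"])
            (auto simp: ind_def split: if_splits simp del: mult_Suc_right)
      next
        case 3
        thus ?thesis by (intro exI[of _ "ind (\<lambda>k. k = Suc (Suc i))"])
            (auto simp: ind_def split: if_splits simp del: mult_Suc_right)
      qed
    qed simp
    moreover have "?T - {2 * Suc (Suc i)} = {Suc (2 * i), 2 * Suc i}" by auto
    ultimately show ?thesis by simp
  qed
  have "insert 2 (range (\<lambda>i. Suc (2 * Suc i))) \<in> fan.truncated_indep"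
  proof -
    let ?R = "range (\<lambda>i. Suc (2 * Suc i))"
    \<comment> \<open>Padded again: spoke \<open>0\<close> completes the set to a spanning
      tree.\<close>
    let ?T = "insert 0 (insert 2 ?R)"
    have spoke2: "fan_edge 0 = monom 1 0" "fan_edge 2 = monom 1 1"
      using fan_edge_spoke[of 0] fan_edge_spoke[of 1] by simp_all
    have "?T - {0} \<in> fan.truncated_indep"
    proof (rule cuts_imp_truncated_indep)
      fix e assume "e \<in> ?T"
      then consider "e = 0" | "e = 2" | i where "e = Suc (2 * Suc i)" by blast
      thus "\<exists>x. cut x (fan_edge e) \<noteq> 0 \<and> (\<forall>d\<in>?T - {e}. cut x (fan_edge d) = 0)"
      proof cases
        case 1
        thus ?thesis by (intro exI[of _ "ind (\<lambda>k. k = 0)"])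
            (auto simp: ind_def spoke2 split: if_splits simp del: mult_Suc_right)
      next
        case 2
        thus ?thesis by (intro exI[of _ "ind (\<lambda>k. k > 0)"])
            (auto simp: ind_def spoke2 split: if_splits simp del: mult_Suc_right)
      next
        case 3
        thus ?thesis by (intro exI[of _ "ind (\<lambda>k. k > Suc i)"])
            (auto simp: ind_def spoke2 split: if_splits simp del: mult_Suc_right)
      qed
    qed simp
    moreover have "?T - {0} = insert 2 ?R" by auto
    ultimately show ?thesis by simp
  qed
  thus False
    using fan_ray_thinly_dependent[OF K f] spokes spokes' ray ray' triangle pair
    unfolding eq by blast
qed

section \<open>Thin dependences over the rationals\<close>

abbreviation rat_field :: "rat ring" where
  "rat_field \<equiv> ring_of_type_algebra"

lemma field_rat_field: "field rat_field"
  by (rule field_from_type_algebra)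

lemma finsum_rat_field: "finite S \<Longrightarrow> (\<Oplus>\<^bsub>rat_field\<^esub>e\<in>S. g e) = sum g S"
proof (induction S rule: finite_induct)
  case empty
  interpret field rat_field by (rule field_rat_field)
  have "\<zero>\<^bsub>rat_field\<^esub> = 0" by (simp add: ring_of_type_algebra_def)
  thus ?case by simp
next
  case (insert e S)
  interpret field rat_field by (rule field_rat_field)
  have "(\<Oplus>\<^bsub>rat_field\<^esub>e\<in>insert e S. g e) = g e \<oplus>\<^bsub>rat_field\<^esub> (\<Oplus>\<^bsub>rat_field\<^esub>e\<in>S. g e)"
    using insert.hyps by (intro finsum_insert) (auto simp: ring_of_type_algebra_def)
  thus ?case using insert by (simp add: ring_of_type_algebra_def)
qed

lemma thin_dependence_rat_field:
  "thin_dependence rat_field A UNIV f l \<longleftrightarrow>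
     (\<forall>a\<in>A. finite {e. l e * f e a \<noteq> 0} \<and> (\<Sum>e | l e * f e a \<noteq> 0. l e * f e a) = 0)"
proof -
  have "l e \<otimes>\<^bsub>rat_field\<^esub> f e a = l e * f e a" "\<zero>\<^bsub>rat_field\<^esub> = 0" for e a
    by (simp_all add: ring_of_type_algebra_def)
  moreover have "l \<in> UNIV \<rightarrow> carrier rat_field" by (simp add: ring_of_type_algebra_def)
  ultimately show ?thesis
    unfolding thin_dependence_def by (auto simp: finsum_rat_field)
qed

text \<open>Row \<open>Suc i\<close> is the signed cycle vector of a triangle. Row \<open>0\<close> has infinite support;
  it makes the potentials eventually constant and is nonzero on all bonds.\<close>

definition fan_row :: "nat \<Rightarrow> nat \<Rightarrow> rat" where
  "fan_row e a = (case a of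
     0 \<Rightarrow> if e = 0 then 1 else if odd e then of_nat (e div 2) + 2 else 0
   | Suc i \<Rightarrow> if e = 2 * i \<or> e = Suc (2 * i) then 1 else if e = 2 * Suc i then - 1 else 0)"

lemma sum_fan_row_Suc:
  "{e. l e * fan_row e (Suc i) \<noteq> 0} \<subseteq> {2 * i, Suc (2 * i), 2 * Suc i}"
  "(\<Sum>e | l e * fan_row e (Suc i) \<noteq> 0. l e * fan_row e (Suc i))
     = l (2 * i) + l (Suc (2 * i)) - l (2 * Suc i)"
proof -
  show sub: "{e. l e * fan_row e (Suc i) \<noteq> 0} \<subseteq> {2 * i, Suc (2 * i), 2 * Suc i}"
    by (auto simp: fan_row_def)
  have "(\<Sum>e | l e * fan_row e (Suc i) \<noteq> 0. l e * fan_row e (Suc i))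
      = (\<Sum>e\<in>{2 * i, Suc (2 * i), 2 * Suc i}. l e * fan_row e (Suc i))"
    using sub by (intro sum.mono_neutral_left) auto
  also have "\<dots> = l (2 * i) + l (Suc (2 * i)) - l (2 * Suc i)"
    by (simp add: fan_row_def)
  finally show "(\<Sum>e | l e * fan_row e (Suc i) \<noteq> 0. l e * fan_row e (Suc i))
     = l (2 * i) + l (Suc (2 * i)) - l (2 * Suc i)" .
qed

text \<open>Summation by parts: the weight \<open>i + 2\<close> on rim edge \<open>i\<close> and the
  entry \<open>1\<close> at spoke \<open>0\<close> make every potential before \<open>n\<close>
  appear with coefficient \<open>- 1\<close>.\<close>

lemma sum_fan_row_0:
  assumes rim: "\<And>i. l (Suc (2 * i)) = l (2 * Suc i) - l (2 * i)"
    and const: "\<And>i. i \<ge> n \<Longrightarrow> l (2 * i) = l (2 * n)"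
  shows "{e. l e * fan_row e 0 \<noteq> 0} \<subseteq> insert 0 ((\<lambda>i. Suc (2 * i)) ` {..<n})"
    and "(\<Sum>e | l e * fan_row e 0 \<noteq> 0. l e * fan_row e 0)
      = (of_nat n + 1) * l (2 * n) - (\<Sum>i<n. l (2 * i))"
proof -
  let ?T = "\<lambda>n. insert 0 ((\<lambda>i. Suc (2 * i)) ` {..<n})"
  have "l e * fan_row e 0 = 0" if "e \<notin> ?T n" for e
  proof (cases e rule: fan_edge_cases)
    case (spoke i)
    thus ?thesis using that by (auto simp: fan_row_def)
  next
    case (rim i)
    hence "i \<ge> n" using that by auto
    hence "l e = 0" using rim assms(1)[of i] const[of i] const[of "Suc i"] by simp
    thus ?thesis by simp
  qed
  thus sub: "{e. l e * fan_row e 0 \<noteq> 0} \<subseteq> ?T n" by blast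
  hence "(\<Sum>e | l e * fan_row e 0 \<noteq> 0. l e * fan_row e 0) = (\<Sum>e\<in>?T n. l e * fan_row e 0)"
    by (intro sum.mono_neutral_left) auto
  also have "\<dots> = (of_nat n + 1) * l (2 * n) - (\<Sum>i<n. l (2 * i))"
  proof -
    have "(\<Sum>e\<in>?T m. l e * fan_row e 0) = (of_nat m + 1) * l (2 * m) - (\<Sum>i<m. l (2 * i))" for m
    proof (induction m)
      case 0
      show ?case by (simp add: fan_row_def)
    next
      case (Suc m)
      have "?T (Suc m) = insert (Suc (2 * m)) (?T m)" by (auto simp: lessThan_Suc)
      moreover have "Suc (2 * m) \<notin> ?T m" by auto
      ultimately have "(\<Sum>e\<in>?T (Suc m). l e * fan_row e 0)
          = l (Suc (2 * m)) * (of_nat m + 2) + (\<Sum>e\<in>?T m. l e * fan_row e 0)"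
        by (simp add: fan_row_def)
      thus ?case unfolding Suc.IH rim by (simp add: algebra_simps)
    qed
    thus ?thesis .
  qed
  finally show "(\<Sum>e | l e * fan_row e 0 \<noteq> 0. l e * fan_row e 0)
      = (of_nat n + 1) * l (2 * n) - (\<Sum>i<n. l (2 * i))" .
qed

text \<open>The triangle rows turn rim coefficients into potential differences. Finiteness on row
  \<open>0\<close>, whose rim weights are all nonzero, makes the potential eventually constant, and
  \<open>sum_fan_row_0\<close> evaluates that row.\<close>

lemma thin_dependence_fan_row_iff:
  "thin_dependence rat_field UNIV UNIV fan_row l \<longleftrightarrow>
     (\<forall>i. l (Suc (2 * i)) = l (2 * Suc i) - l (2 * i)) \<and>
     (\<exists>n. (\<forall>i\<ge>n. l (2 * i) = l (2 * n)) \<and> (of_nat n + 1) * l (2 * n) = (\<Sum>i<n. l (2 * i)))"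
  (is "?L \<longleftrightarrow> ?rim \<and> (\<exists>n. ?const n \<and> ?sum n)")
proof
  assume L: ?L
  have rim: "l (Suc (2 * i)) = l (2 * Suc i) - l (2 * i)" for i
    using L sum_fan_row_Suc(2)[of l i] unfolding thin_dependence_rat_field by force
  have "finite {e. l e * fan_row e 0 \<noteq> 0}"
    using L unfolding thin_dependence_rat_field by blast
  then obtain n where n: "\<And>e. l e * fan_row e 0 \<noteq> 0 \<Longrightarrow> e < n"
    unfolding finite_nat_set_iff_bounded by blast
  have step: "l (2 * Suc i) = l (2 * i)" if "i \<ge> n" for i
  proof (rule ccontr)
    assume "l (2 * Suc i) \<noteq> l (2 * i)"
    hence "l (Suc (2 * i)) * fan_row (Suc (2 * i)) 0 \<noteq> 0"
      using rim[of i] by (simp add: fan_row_def add_nonneg_eq_0_iff)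
    from n[OF this] that show False by simp
  qed
  have const: "l (2 * i) = l (2 * n)" if "i \<ge> n" for i
    using that by (induction i rule: dec_induct) (simp_all add: step del: mult_Suc_right)
  moreover have "?sum n"
    using sum_fan_row_0(2)[of l n, OF rim const] L unfolding thin_dependence_rat_field by simp
  ultimately show "?rim \<and> (\<exists>n. ?const n \<and> ?sum n)" using rim by blast
next
  assume "?rim \<and> (\<exists>n. ?const n \<and> ?sum n)"
  then obtain n where rim: "\<And>i. l (Suc (2 * i)) = l (2 * Suc i) - l (2 * i)"
    and const: "\<And>i. i \<ge> n \<Longrightarrow> l (2 * i) = l (2 * n)" and sum: "?sum n" by blast
  have "finite {e. l e * fan_row e a \<noteq> 0} \<and> (\<Sum>e | l e * fan_row e a \<noteq> 0. l e * fan_row e a) = 0"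
    for a
  proof (cases a)
    case 0
    have "finite {e. l e * fan_row e 0 \<noteq> 0}"
      using finite_subset[OF sum_fan_row_0(1)[of l n, OF rim const]] by simp
    thus ?thesis using sum_fan_row_0(2)[of l n, OF rim const] sum 0 by simp
  next
    case (Suc i)
    have "finite {e. l e * fan_row e (Suc i) \<noteq> 0}"
      using finite_subset[OF sum_fan_row_Suc(1)[of l i]] by simp
    thus ?thesis using sum_fan_row_Suc(2)[of l i] rim[of i] Suc by simp
  qed
  thus ?L unfolding thin_dependence_rat_field by blast
qed

text \<open>The vertices reachable from \<open>i\<close> along the rim edges in \<open>Z\<close>.\<close>

definition rim_component :: "nat set \<Rightarrow> nat \<Rightarrow> nat set" where
  "rim_component Z i = {j. \<forall>k. i \<le> k \<and> k < j \<or> j \<le> k \<and> k < i \<longrightarrow> Suc (2 * k) \<in> Z}"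

lemma rim_component_refl: "i \<in> rim_component Z i"
  by (auto simp: rim_component_def)

lemma rim_component_sym: "j \<in> rim_component Z i \<longleftrightarrow> i \<in> rim_component Z j"
  by (auto simp: rim_component_def)

lemma rim_component_Suc_iff:
  assumes "Suc (2 * k) \<in> Z"
  shows "Suc k \<in> rim_component Z i \<longleftrightarrow> k \<in> rim_component Z i"
proof -
  have "(i \<le> m \<and> m < Suc k \<or> Suc k \<le> m \<and> m < i \<longrightarrow> Suc (2 * m) \<in> Z)
      \<longleftrightarrow> (i \<le> m \<and> m < k \<or> k \<le> m \<and> m < i \<longrightarrow> Suc (2 * m) \<in> Z)" for m
  proof (cases "m = k")
    case False
    hence "m < Suc k \<longleftrightarrow> m < k" "Suc k \<le> m \<longleftrightarrow> k \<le> m" by auto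
    thus ?thesis by simp
  qed (simp add: assms)
  thus ?thesis by (simp only: rim_component_def mem_Collect_eq)
qed

text \<open>A missing rim edge beyond \<open>i\<close> bounds the component, and without one it
  contains the whole tail. Its indicator is thus an eventually constant potential.\<close>

lemma rim_component_eventually_const:
  "\<exists>n. \<forall>k\<ge>n. k \<in> rim_component Z i \<longleftrightarrow> n \<in> rim_component Z i"
proof (cases "\<exists>k\<ge>i. Suc (2 * k) \<notin> Z")
  case True
  then obtain k where k: "k \<ge> i" "Suc (2 * k) \<notin> Z" by blast
  hence "j \<notin> rim_component Z i" if "j \<ge> Suc k" for j
    using that unfolding rim_component_def by (auto intro!: exI[of _ k])
  thus ?thesis by blast
next
  case False
  hence "k \<in> rim_component Z i" if "k \<ge> i" for k using that by (auto simp: rim_component_def)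
  thus ?thesis by blast
qed

text \<open>An equivalence relation respected by the edges in \<open>Z\<close> contains
  reachability. This carries span membership and equality of coefficients along a component.\<close>

lemma rim_component_induct [consumes 1, case_names refl step sym trans]:
  assumes "j \<in> rim_component Z i"
    and refl: "\<And>k. R k k" and step: "\<And>k. Suc (2 * k) \<in> Z \<Longrightarrow> R k (Suc k)"
    and sym: "\<And>k m. R k m \<Longrightarrow> R m k" and trans: "\<And>k m n. R k m \<Longrightarrow> R m n \<Longrightarrow> R k n"
  shows "R i j"
proof -
  have up: "R i j" if "i \<le> j" "\<And>k. i \<le> k \<Longrightarrow> k < j \<Longrightarrow> Suc (2 * k) \<in> Z" for i j
    using that
  proof (induction j rule: dec_induct)
    case base
    show ?case by (rule refl)
  next
    case (step j)
    have "R i j" using step.prems by (intro step.IH) simp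
    moreover have "R j (Suc j)" using step by (intro assms(3)) simp
    ultimately show ?case by (rule trans)
  qed
  show ?thesis
  proof (cases "i \<le> j")
    case True
    thus ?thesis using assms(1) by (intro up) (auto simp: rim_component_def)
  next
    case False
    hence "R j i" using assms(1) by (intro up) (auto simp: rim_component_def)
    thus ?thesis by (rule sym)
  qed
qed

text \<open>An indicator is the potential of a bond, and the sum is its value on row \<open>0\<close>.\<close>

lemma indicator_row_nonzero:
  fixes D :: "nat set"
  assumes const: "\<And>k. k \<ge> n \<Longrightarrow> k \<in> D \<longleftrightarrow> n \<in> D" and ne: "D \<noteq> {}"
  shows "(of_nat n + 1) * of_bool (n \<in> D) \<noteq> (\<Sum>k<n. of_bool (k \<in> D) :: rat)"
proof -
  have sum: "(\<Sum>k<n. of_bool (k \<in> D) :: rat) = of_nat (card (D \<inter> {..<n}))"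
    by (simp add: of_bool_def sum.If_cases Int_commute Int_def)
  have "card (D \<inter> {..<n}) \<le> card {..<n}" by (rule card_mono) auto
  hence le: "card (D \<inter> {..<n}) < n + 1" by simp
  \<comment> \<open>If \<open>D\<close> contains a tail, the left side exceeds any count below
    \<open>n\<close>; otherwise it is zero while all of the nonempty \<open>D\<close> lies below
    \<open>n\<close>.\<close>
  show ?thesis
  proof (cases "n \<in> D")
    case True
    have "of_nat (card (D \<inter> {..<n})) \<noteq> (of_nat (n + 1) :: rat)"
      using le by (simp only: of_nat_eq_iff)
    thus ?thesis using True sum by (simp add: eq_commute)
  next
    case False
    hence "D \<subseteq> {..<n}" using const not_less by blast
    hence "card (D \<inter> {..<n}) \<noteq> 0" using ne by (auto simp: Int_absorb2 finite_subset)
    thus ?thesis using False sum by simp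
  qed
qed

text \<open>Both sides fail exactly when the graph with edge set \<open>- S\<close> has two different components
  avoiding the apex.\<close>

lemma dual_truncated_fan_eq_thinly_indep:
  "dual_indep UNIV fan.truncated_indep = thinly_indep rat_field UNIV UNIV fan_row"
proof (rule Set.set_eqI)
  fix S :: "nat set"
  define C where "C = rim_component (- S)"
  have C_refl: "i \<in> C i" for i by (simp add: C_def rim_component_refl)
  have C_Suc: "Suc k \<in> C i \<longleftrightarrow> k \<in> C i" if "Suc (2 * k) \<notin> S" for i k
    using that rim_component_Suc_iff[of k "- S" i] by (simp add: C_def)
  \<comment> \<open>After deletion of \<open>S\<close>, vertex \<open>i\<close> is disconnected from
    the apex; the indicator \<open>x i\<close> is then the potential of a bond inside
    \<open>S\<close>.\<close>
  define free where "free i \<longleftrightarrow> (\<forall>n\<in>C i. 2 * n \<in> S)" for i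
  define x :: "nat \<Rightarrow> nat \<Rightarrow> rat" where "x i k = of_bool (k \<in> C i)" for i k
  have zero: "\<zero>\<^bsub>rat_field\<^esub> = 0" by (simp add: ring_of_type_algebra_def)
  show "S \<in> dual_indep UNIV fan.truncated_indep \<longleftrightarrow> S \<in> thinly_indep rat_field UNIV UNIV fan_row"
  proof (cases "\<exists>i j. free i \<and> free j \<and> j \<notin> C i")
    case True
    then obtain i j where free: "free i" "free j" and nij: "j \<notin> C i" by blast
    have nji: "i \<notin> C j" using nij rim_component_sym by (simp add: C_def)
    have x_eq: "x i i = 1" "x j j = 1" "x i j = 0" "x j i = 0"
      using nij nji by (simp_all add: x_def C_refl)
    have spoke: "x h k = 0" if "2 * k \<notin> S" "free h" for h k
      using that unfolding free_def x_def by auto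
    have rim: "x h (Suc k) = x h k" if "Suc (2 * k) \<notin> S" for h k
      using C_Suc[OF that] by (simp add: x_def)
    have "S \<notin> dual_indep UNIV fan.truncated_indep"
    proof
      assume "S \<in> dual_indep UNIV fan.truncated_indep"
      then obtain B where B: "B \<in> bases fan.truncated_indep" "B \<subseteq> - S"
        unfolding dual_indep_def by blast
      obtain u where u: "range fan_edge \<subseteq> fan.span (insert u (fan_edge ` B))"
        using fan.maximal_truncated_indep_hyperplane B(1) unfolding bases_def by blast
      have cutB: "cut (x h) v = 0" if v: "v \<in> fan_edge ` B" and h: "free h" for v h
      proof -
        obtain e where "e \<notin> S" "v = fan_edge e" using v B(2) by blast
        thus ?thesis
          by (cases e rule: fan_edge_cases) (simp_all add: spoke[OF _ h] rim)
      qed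
      have span: "monom 1 k \<in> fan.span (insert u (fan_edge ` B))" for k
        using u rangeI[of fan_edge "2 * k"] unfolding fan_edge_spoke by (rule subsetD)
      \<comment> \<open>Both functionals vanish on \<open>B\<close>, and only \<open>u\<close> is
        missing from a spanning set, so they are proportional. Evaluating at vertex \<open>j\<close>
        forces \<open>cut (x i)\<close> to vanish at \<open>u\<close> too.\<close>
      have "cut (x j) u * cut (x i) (monom 1 k) = cut (x i) u * cut (x j) (monom 1 k)" for k
        by (rule cut_span[OF span]) (auto simp: cutB free mult.commute)
      from this[of i] this[of j] have "cut (x i) u = 0" by (simp add: x_eq)
      hence "cut (x i) (monom 1 i) = 0" by (intro cut_span_0[OF span]) (auto simp: cutB free)
      thus False by (simp add: x_eq)
    qed
    moreover have "S \<notin> thinly_indep rat_field UNIV UNIV fan_row"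
    proof
      assume ind: "S \<in> thinly_indep rat_field UNIV UNIV fan_row"
      obtain p q where pq: "\<And>k. k \<ge> p \<Longrightarrow> k \<in> C i \<longleftrightarrow> p \<in> C i" "\<And>k. k \<ge> q \<Longrightarrow> k \<in> C j \<longleftrightarrow> q \<in> C j"
        using rim_component_eventually_const[of "- S" i] rim_component_eventually_const[of "- S" j]
        unfolding C_def by blast
      define n where "n = max p q"
      have Ci: "k \<in> C i \<longleftrightarrow> n \<in> C i" and Cj: "k \<in> C j \<longleftrightarrow> n \<in> C j" if "k \<ge> n" for k
        using that pq(1)[of k] pq(1)[of n] pq(2)[of k] pq(2)[of n] by (simp_all add: n_def)
      \<comment> \<open>The value of row \<open>0\<close> on a bond. Neither bond alone is a thin
        dependence, but the combination \<open>y\<close> cancels row \<open>0\<close>.\<close>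
      define r where "r h = (of_nat n + 1) * x h n - (\<Sum>k<n. x h k)" for h
      have "C i \<noteq> {}" using C_refl by blast
      hence ri: "r i \<noteq> 0" using indicator_row_nonzero[OF Ci] by (simp add: r_def x_def)
      define y where "y k = r j * x i k - r i * x j k" for k
      define l where "l e = (if even e then y (e div 2) else y (Suc (e div 2)) - y (e div 2))" for e
      have l_spoke: "l (2 * k) = y k" and l_rim: "l (Suc (2 * k)) = y (Suc k) - y k" for k
        by (simp_all add: l_def)
      have "(of_nat n + 1) * y n - (\<Sum>k<n. y k)
          = r j * ((of_nat n + 1) * x i n - (\<Sum>k<n. x i k))
            - r i * ((of_nat n + 1) * x j n - (\<Sum>k<n. x j k))"
        by (simp add: y_def sum_subtractf sum_distrib_left[symmetric] algebra_simps)
      also have "\<dots> = 0" by (simp flip: r_def)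
      finally have "(of_nat n + 1) * y n = (\<Sum>k<n. y k)" by simp
      moreover have "y k = y n" if "k \<ge> n" for k using Ci[OF that] Cj[OF that] by (simp add: y_def x_def)
      ultimately have "thin_dependence rat_field UNIV UNIV fan_row l"
        unfolding thin_dependence_fan_row_iff l_spoke l_rim by blast
      moreover have "l e = 0" if "e \<notin> S" for e
        using that by (cases e rule: fan_edge_cases)
          (simp_all add: l_spoke l_rim y_def spoke free rim)
      ultimately have "l (2 * j) = 0" using ind unfolding thinly_indep_def zero by blast
      thus False using ri by (simp add: l_spoke y_def x_eq)
    qed
    ultimately show ?thesis by blast
  next
    case False
    have "S \<in> dual_indep UNIV fan.truncated_indep"
    proof -
      define Z where "Z = fan_edge ` (- S)"
      obtain i where i: "\<And>j. free j \<Longrightarrow> j \<in> C i" using False by blast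
      have diff: "monom 1 k - monom 1 j \<in> fan.span Z" if "j \<in> C k" for j k
        using that unfolding C_def
      proof (induction rule: rim_component_induct)
        case (refl k)
        show ?case by (simp add: fan.span_zero)
      next
        case (step k)
        hence "fan_edge (Suc (2 * k)) \<in> Z" unfolding Z_def by blast
        thus ?case by (simp add: fan.span_base)
      next
        case (sym k m)
        thus ?case using fan.span_neg[of "monom 1 k - monom 1 m" Z] by simp
      next
        case (trans k m n)
        from fan.span_add[OF this] show ?case by simp
      qed
      let ?u = "monom 1 i"
      have mono: "v \<in> fan.span (insert ?u Z)" if "v \<in> fan.span Z" for v
        using that fan.span_mono[OF subset_insertI] by blast
      \<comment> \<open>Edges outside \<open>S\<close> join every rim vertex to \<open>i\<close> or
        to the apex, so \<open>?u\<close> alone completes them to a spanning set.\<close>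
      have "monom 1 j \<in> fan.span (insert ?u Z)" for j
      proof (cases "free j")
        case True
        hence "?u - monom 1 j \<in> fan.span (insert ?u Z)" using mono diff i by blast
        from fan.span_diff[OF fan.span_base[OF insertI1] this] show ?thesis by simp
      next
        case False
        then obtain k where k: "k \<in> C j" "2 * k \<notin> S" unfolding free_def by blast
        have "fan_edge (2 * k) \<in> Z" using k(2) unfolding Z_def by blast
        hence "monom 1 k \<in> fan.span Z" by (simp add: fan.span_base)
        from mono[OF fan.span_add[OF diff[OF k(1)] this]] show ?thesis by simp
      qed
      hence "range fan_edge \<subseteq> fan.span (insert ?u (fan_edge ` (- S)))"
        unfolding Z_def by (rule fan_spanning)
      then obtain B where "B \<in> bases fan.truncated_indep" "B \<subseteq> - S"
        using fan.base_in_hyperplane[of "- S"] by blast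
      thus ?thesis unfolding dual_indep_def by blast
    qed
    moreover have "S \<in> thinly_indep rat_field UNIV UNIV fan_row"
    proof -
      have "l e = 0" if l: "thin_dependence rat_field UNIV UNIV fan_row l"
        and l0: "\<And>e. e \<notin> S \<Longrightarrow> l e = 0" for l e
      proof -
        obtain n where diff: "\<And>i. l (Suc (2 * i)) = l (2 * Suc i) - l (2 * i)"
          and const: "\<And>i. i \<ge> n \<Longrightarrow> l (2 * i) = l (2 * n)"
          and row: "(of_nat n + 1) * l (2 * n) = (\<Sum>i<n. l (2 * i))"
          using l unfolding thin_dependence_fan_row_iff by blast
        have comp: "l (2 * i) = l (2 * j)" if "j \<in> C i" for i j
          using that unfolding C_def
        proof (induction rule: rim_component_induct)
          case (step k)
          hence "l (Suc (2 * k)) = 0" by (intro l0) simp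
          thus ?case using diff[of k] by simp
        qed simp_all
        have notfree: "l (2 * j) = 0" if "\<not> free j" for j
        proof -
          obtain k where "k \<in> C j" "2 * k \<notin> S" using \<open>\<not> free j\<close> unfolding free_def by blast
          thus ?thesis using comp l0 by simp
        qed
        have spoke: "l (2 * i) = 0" for i
        proof (rule ccontr)
          assume nz: "l (2 * i) \<noteq> 0"
          \<comment> \<open>The potential is constant on components and zero off the only free one,
            so it is a multiple of the indicator of \<open>D\<close>, which row \<open>0\<close>
            does not annihilate.\<close>
          define D where "D = {j. l (2 * j) = l (2 * i)}"
          have eq: "l (2 * j) = l (2 * i) * of_bool (j \<in> D)" for j
          proof (cases "free j")
            case True
            have "free i" using notfree nz by blast
            hence "j \<in> C i" using True False by blast
            thus ?thesis using comp[of j i] by (simp add: D_def)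
          next
            case False
            thus ?thesis using notfree[OF False] nz by (simp add: D_def)
          qed
          have "(of_nat n + 1) * of_bool (n \<in> D) \<noteq> (\<Sum>k<n. of_bool (k \<in> D) :: rat)"
          proof (rule indicator_row_nonzero)
            fix k assume "k \<ge> n"
            from const[OF this] show "k \<in> D \<longleftrightarrow> n \<in> D" by (simp add: D_def)
          qed (auto simp: D_def)
          moreover have "l (2 * i) * ((of_nat n + 1) * of_bool (n \<in> D))
              = (of_nat n + 1) * (l (2 * i) * of_bool (n \<in> D))" by (rule mult.left_commute)
          hence "l (2 * i) * ((of_nat n + 1) * of_bool (n \<in> D))
              = l (2 * i) * (\<Sum>k<n. of_bool (k \<in> D))"
            by (simp only: eq[symmetric] row sum_distrib_left)
          ultimately show False using nz by simp
        qed
        show ?thesis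
        proof (cases e rule: fan_edge_cases)
          case (rim i)
          thus ?thesis using diff[of i] spoke[of i] spoke[of "Suc i"] by simp
        qed (simp add: spoke)
      qed
      thus ?thesis unfolding thinly_indep_def zero by blast
    qed
    ultimately show ?thesis by blast
  qed
qed

theorem theorem1p3:
  shows "\<exists>(E :: nat set) \<I>. thin_sums_matroid E \<I> \<and> \<not> thin_sums_matroid E (dual_indep E \<I>)"
proof (intro exI conjI)
  \<comment> \<open>The witness is the dual, so that its own dual is the truncation again.\<close>
  let ?I = "dual_indep UNIV fan.truncated_indep"
  have "fan_row \<in> UNIV \<rightarrow> UNIV \<rightarrow> carrier rat_field" by (simp add: ring_of_type_algebra_def)
  hence "is_thin_sums_matroid_of rat_field UNIV UNIV fan_row ?I"
    unfolding is_thin_sums_matroid_of_def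
    using field_rat_field fan.truncation.matroid_dual dual_truncated_fan_eq_thinly_indep by blast
  thus "thin_sums_matroid UNIV ?I" by (rule thin_sums_matroidI)
  show "\<not> thin_sums_matroid UNIV (dual_indep UNIV ?I)"
    unfolding fan.truncation.dual_indep_dual_indep by (rule truncated_fan_not_thin)
qed

end
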